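(* Consider the stochastic programming problem $$\min_{x\in\mathbb{R}^n}\ \sum_{i=1}^{\ell}\pi_if_i(x_i)\quad\text{subject to}\quad Mx\in\mathcal{N},$$ with the notation given in the context, where each $f_i:\mathbb{R}^{\bar n}\to\mathbb{R}\cup\{+\infty\}$, $i=1,\dots,\ell$, is closed proper convex, and let $f(x)=\sum_{i=1}^\ell\pi_if_i(x_i)$. For each $i\in\{1,\dots,\ell\}$, let $\{\sigma_{ik}\}_{k=0}^\infty$ be a sequence of nonnegative reals with $\sum_{k=0}^\infty\sqrt{\sigma_{ik}}<\infty$, and let $\{\nu_k\}_{k=0}^\infty\subset\mathbb{R}$ satisfy $\inf_k\nu_k>0$ and $\sup_k\nu_k<2$. For arbitrary initial $z^0\in\mathcal{N}$ and $w^0\in\mathcal{N}^*$, suppose that the sequences $\{z^k\}_{k=0}^\infty,\{v^k\}_{k=1}^\infty\subset\mathcal{N}$, $\{w^k\}_{k=0}^\infty\subset\mathcal{N}^*$ and $\{x^k\}_{k=1}^\infty\subset\mathbb{R}^n$ satisfy the following recursions for all $k\ge0$: $$x_i^{k+1}\in\sigma_{ik}\text{-}\!\operatorname*{arg\,min}_{x_i\in\mathbb{R}^{\bar n}}\Big\{f_i(x_i)+\sum_{t=1}^{T-1}\sum_{j=1}^{n_t}\Big(w_{itj}^kx_{itj}+\frac{\rho_{tj}}{2}(x_{itj}-z_{itj}^k)^2\Big)\Big\}\quad\text{for all }i\in\{1,\dots,\ell\},$$ $$v_{i\,t(N)\,j}^{k+1}=\frac1{\pi(N)}\sum_{i'\in\mathcal{D}(N)}\pi_{i'}x_{i'\,t(N)\,j}^{k+1}\quad\text{for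 all }N\in\mathcal{U},\ i\in\mathcal{D}(N),\ j\in\{1,\dots,n_{t(N)}\},$$ $$z_{itj}^{k+1}=\nu_kv_{itj}^{k+1}+(1-\nu_k)z_{itj}^k,\qquad w_{itj}^{k+1}=w_{itj}^k+\nu_k\rho_{tj}\big(x_{itj}^{k+1}-v_{itj}^{k+1}\big)$$ for all $i\in\{1,\dots,\ell\}$, $t\in\{1,\dots,T-1\}$, $j\in\{1,\dots,n_t\}$, where the exact minimum in each of the first minimizations is assumed to be attained. If strong duality holds, then $\{w^k\}$ converges to some $w^*\in\mathcal{N}^*$ such that $p^*\in\mathcal{N}^\perp$ defined by $p_{itj}^*=\pi_iw_{itj}^*$ for all $i,t,j$ is a solution to the dual problem $$\min_{p\in\mathcal{N}^\perp}\ \sum_{i=1}^\ell(\pi_if_i)^*(-\overline M^\top p_i),$$ while $\{z^k\}$, $\{v^k\}$, and $\{Mx^k\}$ converge to some $z^*\in\mathcal{N}$ such that $$-z_i^*\in\partial\big((\pi_if_i)^*\circ(-\overline M^\top)\big)(\pi_iw_i^* )\quad\text{for all }i\in\{1,\dots,\ell\}.$$ If the regularity condition $\operatorname{ri}\operatorname{im}\partial f\cap\operatorname{im}M^\top\neq\emptyset$ is also true, then $z^*=Mx^*$, where $x^*$ is some solution of the primal problem $\min_{x\in\mathbb{R}^n}\{f(x)\mid Mx\in\mathcal{N}\}$. In this case, all limit points of $\{x^k\}$ are optimal primal solutions, and for every $i\in\{1,\dots,\ell\}$ there exists $x_{iT}^*\in\mathbb{R}^{n_T}$ such that $(-w_i^*,0)\in\partial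 f_i(z_i^*,x_{iT}^* )$. If the dual problem has no solution but there exists some $\bar p\in\mathbb{R}^m$ at which the dual objective is finite, then at least one of the sequences $\{w^k\}$ or $\{z^k\}$ must be unbounded.
   Context: Scenario tree: a finite tree with stages $t=1,\dots,T$ and $\ell$ leaf nodes (scenarios, all at stage $T$) indexed by $i\in\{1,\dots,\ell\}$. For a node $N$, $t(N)$ is its stage; $\mathcal{U}$ is the set of non-leaf nodes (nodes at stages $1,\dots,T-1$); $\mathcal{D}(N)\subseteq\{1,\dots,\ell\}$ is the set of leaves that are descendants of $N$. For each $t$, the sets $\mathcal{D}(N)$ over the stage-$t$ nodes $N$ form a partition of $\{1,\dots,\ell\}$. Leaf $i$ has probability $\pi_i\in(0,1]$, $\sum_i\pi_i=1$, and $\pi(N)=\sum_{i\in\mathcal{D}(N)}\pi_i$. Variables: each stage-$t$ node has $n_t\ge1$ decision variables; $\bar n=\sum_{t=1}^Tn_t$, $\bar m=\bar n-n_T$, $n=\ell\bar n$, $m=\ell\bar m$. A vector $x\in\mathbb{R}^n$ consists of subvectors $x_i\in\mathbb{R}^{\bar n}$, with $x_i=(x_{i1},\dots,x_{iT})$, $x_{it}\in\mathbb{R}^{n_t}$ having elements $x_{itj}$. Vectors in $\mathbb{R}^m$ (such as $z,v,w,p$) are indexed the same way but with $t$ only in $\{1,\dots,T-1\}$. $\overline M:\mathbb{R}^{\bar n}\to\mathbb{R}^{\bar m}$ drops the last-stage variables, $\overline M(x_{i1},\dots,x_{iT})=(x_{i1},\dots,x_{i,T-1})$, and $M:\mathbb{R}^n\to\mathbb{R}^m$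 is $M(x_1,\dots,x_\ell)=(\overline Mx_1,\dots,\overline Mx_\ell)$. The scalars $\rho_{tj}>0$ ($t\in\{1,\dots,T-1\}$, $j\in\{1,\dots,n_t\}$) are fixed. Subspaces of $\mathbb{R}^m$: $$\mathcal{N}=\{z\in\mathbb{R}^m\mid z_{i\,t(N)}=z_{i'\,t(N)}\ \ \forall N\in\mathcal{U},\ \forall i,i'\in\mathcal{D}(N)\},$$ $$\mathcal{N}^*=\Big\{w\in\mathbb{R}^m\ \Big|\ \sum_{i\in\mathcal{D}(N)}\pi_iw_{i\,t(N)}=0\ \ \forall N\in\mathcal{U}\Big\},$$ and $\mathcal{N}^\perp$ is the orthogonal complement of $\mathcal{N}$. For $\delta\ge0$, $\ \delta\text{-}\!\operatorname*{arg\,min}_{x\in S}\{h(x)\}=\{x\in S\mid h(x)\le(\inf_{y\in S}h(y))+\delta\}$. A superscript $*$ on a function is the convex conjugate; $\partial$ is the convex subdifferential; $(\pi_if_i)^*\circ(-\overline M^\top)$ is $q\mapsto(\pi_if_i)^*(-\overline M^\top q)$; $\operatorname{im}\partial f=\bigcup_x\partial f(x)$; $\operatorname{ri}$ is the relative interior. The dual objective is $\sum_i(\pi_if_i)^*(-\overline M^\top p_i)$ for $p\in\mathcal{N}^\perp$ and $+\infty$ otherwise. "Strong duality holds" means there exist $\hat x\in\mathbb{R}^n$ with $M\hat x\in\mathcal{N}$ and $\hat p\in\mathcal{N}^\perp$ with $f(\hat x)+f^*(-M^\top\hat p)=0$. *)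

theory Defs
  imports "HOL-Analysis.Analysis"
begin

definition closed_proper_convex :: "('a::euclidean_space \<Rightarrow> ereal) \<Rightarrow> bool" where
  "closed_proper_convex f \<longleftrightarrow>
     closed {(x, r::real). f x \<le> ereal r} \<and> convex {(x, r::real). f x \<le> ereal r} \<and>
     (\<forall>x. f x \<noteq> -\<infinity>) \<and> (\<exists>x. f x \<noteq> \<infinity>)"

definition conjugate :: "('a::real_inner \<Rightarrow> ereal) \<Rightarrow> 'a \<Rightarrow> ereal" where
  "conjugate f y = (SUP x. ereal (y \<bullet> x) - f x)"

definition subdifferential :: "('a::real_inner \<Rightarrow> ereal) \<Rightarrow> 'a \<Rightarrow> 'a set" where
  "subdifferential f x = {g. \<forall>y. f x + ereal (g \<bullet> (y - x)) \<le> f y}"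

definition approx_arg_min :: "real \<Rightarrow> 'a set \<Rightarrow> ('a \<Rightarrow> ereal) \<Rightarrow> 'a set" where
  "approx_arg_min \<delta> S h = {x \<in> S. h x \<le> (INF y\<in>S. h y) + ereal \<delta>}"

definition is_minimizer :: "'a set \<Rightarrow> ('a \<Rightarrow> ereal) \<Rightarrow> 'a \<Rightarrow> bool" where
  "is_minimizer S h x \<longleftrightarrow> x \<in> S \<and> (\<forall>y\<in>S. h x \<le> h y)"

text \<open>
  The scenarios are the elements of the finite type \<open>'s\<close>; scenario \<open>i\<close> is located at the
  node \<open>leaf G i\<close>. Edges point from a node to its children.
\<close>

record ('n, 's) scenario_tree =
  nodes :: "'n set"
  edges :: "('n \<times> 'n) set"
  stage :: "'n \<Rightarrow> nat"
  leaf :: "'s \<Rightarrow> 'n"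

definition nonleaf_nodes :: "('n, 's) scenario_tree \<Rightarrow> 'n set" where
  "nonleaf_nodes G = {N \<in> nodes G. \<exists>C. (N, C) \<in> edges G}"

definition leaf_descendants :: "('n, 's) scenario_tree \<Rightarrow> 'n \<Rightarrow> 's set" where
  "leaf_descendants G N = {i. (N, leaf G i) \<in> (edges G)\<^sup>*}"

definition is_scenario_tree :: "nat \<Rightarrow> ('n, 's::finite) scenario_tree \<Rightarrow> bool" where
  "is_scenario_tree T G \<longleftrightarrow>
     finite (nodes G) \<and> edges G \<subseteq> nodes G \<times> nodes G \<and>
     stage G ` nodes G \<subseteq> {1..T} \<and>
     (\<exists>!r. r \<in> nodes G \<and> stage G r = 1) \<and>
     (\<forall>C \<in> nodes G. stage G C \<noteq> 1 \<longrightarrow> (\<exists>!N. (N, C) \<in> edges G)) \<and>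
     (\<forall>(N, C) \<in> edges G. stage G C = Suc (stage G N)) \<and>
     bij_betw (leaf G) UNIV (nodes G - nonleaf_nodes G) \<and>
     (\<forall>i. stage G (leaf G i) = T)"

definition node_prob :: "('n, 's) scenario_tree \<Rightarrow> ('s \<Rightarrow> real) \<Rightarrow> 'n \<Rightarrow> real" where
  "node_prob G \<pi> N = (\<Sum>i \<in> leaf_descendants G N. \<pi> i)"

text \<open>
  The pairs \<open>(t, j)\<close> with \<open>1 \<le> t < T\<close> and \<open>1 \<le> j \<le> n\<^sub>t\<close> are the elements of a finite index
  type \<open>'e\<close>, and a function \<open>\<tau> :: 'e \<Rightarrow> nat\<close> gives the stage \<open>t\<close> of such an index, so that
  \<open>n\<^sub>t = card {e. \<tau> e = t}\<close>. The variables of the last stage are indexed by a type \<open>'d\<close>.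
  One scenario subvector is thus a pair in \<open>real^'e \<times> real^'d\<close>, and the map dropping its
  last-stage part is \<^const>\<open>fst\<close>.
\<close>

abbreviation Mbar :: "(real^'e) \<times> (real^'d) \<Rightarrow> real^'e" where
  "Mbar \<equiv> fst"

definition M :: "((real^'e) \<times> (real^'d))^'s \<Rightarrow> real^'e^'s" where
  "M x = (\<chi> i. Mbar (x $ i))"

definition nonant :: "('n, 's) scenario_tree \<Rightarrow> ('e \<Rightarrow> nat) \<Rightarrow> (real^'e^'s) set" where
  "nonant G \<tau> = {z. \<forall>N \<in> nonleaf_nodes G.
     \<forall>i \<in> leaf_descendants G N. \<forall>i' \<in> leaf_descendants G N.
     \<forall>e. \<tau> e = stage G N \<longrightarrow> z $ i $ e = z $ i' $ e}"

definition nonant_star ::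
    "('n, 's) scenario_tree \<Rightarrow> ('e \<Rightarrow> nat) \<Rightarrow> ('s \<Rightarrow> real) \<Rightarrow> (real^'e^'s) set" where
  "nonant_star G \<tau> \<pi> = {w. \<forall>N \<in> nonleaf_nodes G. \<forall>e. \<tau> e = stage G N \<longrightarrow>
     (\<Sum>i \<in> leaf_descendants G N. \<pi> i * w $ i $ e) = 0}"

definition primal_obj ::
    "('s::finite \<Rightarrow> real) \<Rightarrow> ('s \<Rightarrow> (real^'e) \<times> (real^'d) \<Rightarrow> ereal)
      \<Rightarrow> ((real^'e) \<times> (real^'d))^'s \<Rightarrow> ereal" where
  "primal_obj \<pi> f x = (\<Sum>i\<in>UNIV. ereal (\<pi> i) * f i (x $ i))"

definition dual_term ::
    "('s \<Rightarrow> real) \<Rightarrow> ('s \<Rightarrow> (real^'e::finite) \<times> (real^'d::finite) \<Rightarrow> ereal) \<Rightarrow> 's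
      \<Rightarrow> real^'e \<Rightarrow> ereal" where
  "dual_term \<pi> f i = conjugate (\<lambda>x. ereal (\<pi> i) * f i x) \<circ> (\<lambda>q. - adjoint Mbar q)"

definition dual_obj ::
    "('n, 's::finite) scenario_tree \<Rightarrow> ('e::finite \<Rightarrow> nat) \<Rightarrow> ('s \<Rightarrow> real)
      \<Rightarrow> ('s \<Rightarrow> (real^'e) \<times> (real^'d::finite) \<Rightarrow> ereal) \<Rightarrow> real^'e^'s \<Rightarrow> ereal" where
  "dual_obj G \<tau> \<pi> f p =
     (if p \<in> (nonant G \<tau>)\<^sup>\<bottom> then \<Sum>i\<in>UNIV. dual_term \<pi> f i (p $ i) else \<infinity>)"

definition primal_solution ::
    "('n, 's::finite) scenario_tree \<Rightarrow> ('e \<Rightarrow> nat) \<Rightarrow> ('s \<Rightarrow> real)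
      \<Rightarrow> ('s \<Rightarrow> (real^'e) \<times> (real^'d) \<Rightarrow> ereal) \<Rightarrow> ((real^'e) \<times> (real^'d))^'s \<Rightarrow> bool" where
  "primal_solution G \<tau> \<pi> f = is_minimizer {x. M x \<in> nonant G \<tau>} (primal_obj \<pi> f)"

definition dual_solution ::
    "('n, 's::finite) scenario_tree \<Rightarrow> ('e::finite \<Rightarrow> nat) \<Rightarrow> ('s \<Rightarrow> real)
      \<Rightarrow> ('s \<Rightarrow> (real^'e) \<times> (real^'d::finite) \<Rightarrow> ereal) \<Rightarrow> real^'e^'s \<Rightarrow> bool" where
  "dual_solution G \<tau> \<pi> f =
     is_minimizer ((nonant G \<tau>)\<^sup>\<bottom>) (\<lambda>p. \<Sum>i\<in>UNIV. dual_term \<pi> f i (p $ i))"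

definition strong_duality ::
    "('n, 's::finite) scenario_tree \<Rightarrow> ('e::finite \<Rightarrow> nat) \<Rightarrow> ('s \<Rightarrow> real)
      \<Rightarrow> ('s \<Rightarrow> (real^'e) \<times> (real^'d::finite) \<Rightarrow> ereal) \<Rightarrow> bool" where
  "strong_duality G \<tau> \<pi> f \<longleftrightarrow>
     (\<exists>x p. M x \<in> nonant G \<tau> \<and> p \<in> (nonant G \<tau>)\<^sup>\<bottom> \<and>
        primal_obj \<pi> f x + conjugate (primal_obj \<pi> f) (- adjoint M p) = 0)"

text \<open>
  The function minimized over the subvector of one scenario, with \<open>f\<close>, \<open>w\<close>, \<open>z\<close> the data of
  that scenario.
\<close>

definition subproblem_obj ::
    "('e::finite \<Rightarrow> real) \<Rightarrow> ((real^'e) \<times> (real^'d) \<Rightarrow> ereal) \<Rightarrow> real^'e \<Rightarrow> real^'e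
      \<Rightarrow> (real^'e) \<times> (real^'d) \<Rightarrow> ereal" where
  "subproblem_obj \<rho> f w z x =
     f x + ereal (\<Sum>e\<in>UNIV. w $ e * Mbar x $ e + \<rho> e / 2 * (Mbar x $ e - z $ e)\<^sup>2)"

end

theory Submission
  imports Defs
begin

text \<open>In the inner product weighted by \<open>\<pi> i * \<rho> e\<close>, with \<open>P\<close> the projection onto \<open>\<N>\<close> and
  \<open>s = z + w / \<rho>\<close>, so that \<open>P s = z\<close>, one iteration is a relaxed Douglas-Rachford step
  \<open>s + \<nu> (u - P s)\<close>, where \<open>u\<close> is the part retained by \<open>M\<close> of the solution of the scenario
  subproblems at \<open>(2 P - I) s\<close>. The exact \<open>u\<close> satisfies \<open>- u\<^sub>i \<in> \<partial>h\<^sub>i(\<pi>\<^sub>i (w\<^sub>i + \<rho> (u\<^sub>i - z\<^sub>i)))\<close> with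
  \<open>h\<^sub>i\<close> the \<open>i\<close>-th dual term; this relation is monotone and closed, and by strong convexity the
  computed point has error at most a constant times the square root of \<open>\<sigma>\<close>. A saddle point given by
  strong duality makes the iterates quasi-Fejer monotone, and the residual \<open>u - z\<close> vanishes, so they
  converge to a saddle point of the dual relation.

  For the regularity part, exact subproblem solutions have a bounded image modulo directions that
  \<open>M\<close> annihilates and along which \<open>f\<close> is constant; removing these directions gives a limit \<open>x\<^sup>*\<close>.

  If the iterates are bounded, the contractions \<open>y \<mapsto> D ((1 - \<epsilon>) y)\<close>, with \<open>D\<close> the Douglas-Rachford
  operator, have fixed points that stay in a fixed ball, since otherwise the distance to such a
  fixed point would decrease by a constant in every step. As \<open>\<epsilon>\<close> tends to 0 they accumulate at a
  fixed point of \<open>D\<close>, which yields a dual solution.\<close>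

section \<open>Subgradients of closed proper convex functions\<close>

lemma norm_add_scaleR_squared:
  fixes v d :: "'a::real_inner"
  shows "(norm (v + t *\<^sub>R d))\<^sup>2 = (norm v)\<^sup>2 + 2 * t * (v \<bullet> d) + t * t * (norm d)\<^sup>2"
  by (simp only: power2_norm_eq_inner) (simp add: inner_simps inner_commute)

lemma closed_proper_convex_limit:
  assumes "closed_proper_convex F" and "x \<longlonglongrightarrow> y" and "r \<longlonglongrightarrow> s"
    and "\<And>n. F (x n) \<le> ereal (r n)"
  shows "F y \<le> ereal s"
proof -
  have "closed {(x, r::real). F x \<le> ereal r}"
    using assms(1) by (simp add: closed_proper_convex_def)
  then have "(y, s) \<in> {(x, r::real). F x \<le> ereal r}"
    by (rule closed_sequentially[where f = "\<lambda>n. (x n, r n)"]) (use assms in \<open>auto intro: tendsto_Pair\<close>)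
  then show ?thesis by simp
qed

lemma closed_proper_convex_combination:
  assumes "closed_proper_convex F" and "F x \<le> ereal a" and "F y \<le> ereal b"
    and "0 \<le> t" and "t \<le> 1"
  shows "F (x + t *\<^sub>R (y - x)) \<le> ereal (a + t * (b - a))"
proof -
  have "convex {(x, r::real). F x \<le> ereal r}"
    using assms(1) by (simp add: closed_proper_convex_def)
  from convexD[OF this, of "(x, a)" "(y, b)" "1 - t" t]
  have "F ((1 - t) *\<^sub>R x + t *\<^sub>R y) \<le> ereal ((1 - t) * a + t * b)"
    using assms by simp
  then show ?thesis by (simp add: algebra_simps)
qed

lemma closed_proper_convex_not_minfty:
  assumes "closed_proper_convex F"
  shows "F x \<noteq> -\<infinity>"
  using assms by (simp add: closed_proper_convex_def)

lemma closed_proper_convex_finite_point: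
  assumes "closed_proper_convex F"
  obtains x r where "F x = ereal r"
proof -
  obtain x where "F x \<noteq> \<infinity>" "F x \<noteq> -\<infinity>"
    using assms by (auto simp: closed_proper_convex_def)
  then show thesis using that by (cases "F x") auto
qed

lemma subdifferentialI:
  assumes "F x = ereal a" and "\<And>y. F y \<noteq> -\<infinity>"
    and "\<And>y b. F y = ereal b \<Longrightarrow> a + g \<bullet> (y - x) \<le> b"
  shows "g \<in> subdifferential F x"
  unfolding subdifferential_def
proof (intro CollectI allI)
  fix y
  show "F x + ereal (g \<bullet> (y - x)) \<le> F y"
    using assms(1) assms(2)[of y] assms(3)[of y] by (cases "F y") auto
qed

lemma subdifferentialD:
  assumes "g \<in> subdifferential F x" and "F x = ereal a" and "F y = ereal b"
  shows "a + g \<bullet> (y - x) \<le> b"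
  using assms unfolding subdifferential_def by (metis (mono_tags, lifting) ereal_less_eq(3) mem_Collect_eq plus_ereal.simps(1))

lemma subdifferential_finite:
  assumes "g \<in> subdifferential F x" and "F x \<noteq> -\<infinity>" and "F y \<noteq> \<infinity>"
  obtains a where "F x = ereal a"
proof -
  have "F x + ereal (g \<bullet> (y - x)) \<le> F y"
    using assms by (auto simp: subdifferential_def)
  then show thesis using assms that by (cases "F x") auto
qed

lemma closed_proper_convex_subdifferential_finite:
  assumes "closed_proper_convex F" and "g \<in> subdifferential F x"
  obtains a where "F x = ereal a"
  using assms subdifferential_finite[of g F x] by (auto simp: closed_proper_convex_def)

lemma subdifferential_monotone:
  assumes "closed_proper_convex F" and "g \<in> subdifferential F x" and "h \<in> subdifferential F y"
  shows "0 \<le> (g - h) \<bullet> (x - y)"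
proof -
  obtain a b where ab: "F x = ereal a" "F y = ereal b"
    using closed_proper_convex_subdifferential_finite assms by metis
  have "a + g \<bullet> (y - x) \<le> b" "b + h \<bullet> (x - y) \<le> a"
    using subdifferentialD assms ab by blast+
  then show ?thesis by (simp add: inner_diff)
qed

text \<open>Each subgradient inequality, read as an upper bound on \<open>F (x n)\<close> for fixed
  \<open>u\<close>, has a convergent right-hand side, so lower semicontinuity passes to the limit.
  One finite value of \<open>F\<close> makes \<open>F y\<close> finite.\<close>

lemma subdifferential_closed_graph:
  assumes F: "closed_proper_convex F" and "x \<longlonglongrightarrow> y" and "g \<longlonglongrightarrow> h"
    and g: "\<And>n. g n \<in> subdifferential F (x n)"
  shows "h \<in> subdifferential F y"
proof -
  have le: "F y \<le> ereal (b - h \<bullet> (u - y))" if u: "F u = ereal b" for u b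
  proof (rule closed_proper_convex_limit[OF F])
    show "x \<longlonglongrightarrow> y" by fact
    show "(\<lambda>n. b - g n \<bullet> (u - x n)) \<longlonglongrightarrow> b - h \<bullet> (u - y)"
      by (intro tendsto_intros assms)
    fix n
    obtain a where a: "F (x n) = ereal a"
      using closed_proper_convex_subdifferential_finite F g by metis
    show "F (x n) \<le> ereal (b - g n \<bullet> (u - x n))"
      using subdifferentialD[OF g a u] a by simp
  qed
  obtain u b where "F u = ereal b" using closed_proper_convex_finite_point F .
  then have "F y \<noteq> \<infinity>" using le[of u b] by auto
  moreover note nm = closed_proper_convex_not_minfty[OF F]
  ultimately obtain a where a: "F y = ereal a" by (metis ereal_cases)
  show ?thesis
    using le a nm by (intro subdifferentialI[where F = F, OF a]) force+
qed

text \<open>Compare \<open>x\<close> with the points at parameter \<open>t\<close> on a segment, use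
  convexity of \<open>F\<close>, divide by \<open>t\<close> and let \<open>t\<close> tend to 0. Of
  \<open>h\<close> this takes a second-order upper bound at \<open>x\<close>, with a constant that
  may depend on the direction.\<close>

lemma minimizer_add_subdifferential:
  assumes F: "closed_proper_convex F" and min: "\<And>y. F x + ereal (h x) \<le> F y + ereal (h y)"
    and h: "\<And>d. \<exists>C. \<forall>t\<in>{0<..1}. h (x + t *\<^sub>R d) \<le> h x + t * (g \<bullet> d) + t * t * C"
  shows "- g \<in> subdifferential F x"
proof -
  note nm = closed_proper_convex_not_minfty[OF F]
  obtain u r where "F u = ereal r" using closed_proper_convex_finite_point F .
  then have "F x \<noteq> \<infinity>" using min[of u] by auto
  then obtain a where a: "F x = ereal a" using nm by (metis ereal_cases)
  show ?thesis
  proof (rule subdifferentialI[where F = F, OF a nm])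
    fix y b assume b: "F y = ereal b"
    obtain C where C: "\<And>t. 0 < t \<Longrightarrow> t \<le> 1 \<Longrightarrow> h (x + t *\<^sub>R (y - x)) \<le> h x + t * (g \<bullet> (y - x)) + t * t * C"
      using h[of "y - x"] by force
    have "a - b - g \<bullet> (y - x) \<le> t * C" if t: "0 < t" "t \<le> 1" for t
    proof -
      have "F x + ereal (h x) \<le> F (x + t *\<^sub>R (y - x)) + ereal (h (x + t *\<^sub>R (y - x)))"
        by (rule min)
      also have "\<dots> \<le> ereal (a + t * (b - a)) + ereal (h (x + t *\<^sub>R (y - x)))"
        by (intro add_right_mono closed_proper_convex_combination F) (use a b t in auto)
      finally have "h x \<le> t * (b - a) + h (x + t *\<^sub>R (y - x))"
        using a by simp
      also have "\<dots> \<le> t * (b - a) + (h x + t * (g \<bullet> (y - x)) + t * t * C)"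
        using C t by simp
      finally have "t * (a - b - g \<bullet> (y - x)) \<le> t * (t * C)" by (simp add: algebra_simps)
      then show ?thesis using t by simp
    qed
    then have ev: "eventually (\<lambda>t. a - b - g \<bullet> (y - x) \<le> t * C) (at_right 0)"
      unfolding eventually_at_right_field by (intro exI[of _ 1]) auto
    have "((\<lambda>t. t * C) \<longlongrightarrow> 0 * C) (at_right 0)" by (intro tendsto_intros)
    from tendsto_lowerbound[OF this ev] show "a + - g \<bullet> (y - x) \<le> b" by simp
  qed
qed

text \<open>The affine minorant loses against the quadratic growth of \<open>h\<close>, so
  minimizing sequences are bounded; a cluster point attains the infimum by lower
  semicontinuity.\<close>

lemma minimizer_add_quadratic_exists:
  fixes F :: "'a::euclidean_space \<Rightarrow> ereal"
  assumes F: "closed_proper_convex F" and minor: "\<And>x. ereal (\<alpha> + g \<bullet> (x - a)) \<le> F x"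
    and cont: "continuous_on UNIV h" and c: "c > 0" and h: "\<And>x. c * (norm (x - a))\<^sup>2 \<le> h x"
  obtains x where "\<And>y. F x + ereal (h x) \<le> F y + ereal (h y)"
proof -
  define A where "A = {r. \<exists>x. F x \<le> ereal (r - h x)}"
  \<comment> \<open>\<open>K\<close> arises when Young's inequality absorbs the linear minorant into
    half of the quadratic term; \<open>- K\<close> then bounds \<open>A\<close> from below.\<close>
  define K where "K = (norm g)\<^sup>2 / (2 * c) - \<alpha>"
  note nm = closed_proper_convex_not_minfty[OF F]
  have growth: "c / 2 * (norm (x - a))\<^sup>2 \<le> r + K" if "F x \<le> ereal (r - h x)" for x r
  proof -
    let ?n = "norm (x - a)"
    have "ereal (\<alpha> + g \<bullet> (x - a)) \<le> ereal (r - h x)"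
      using minor that order_trans by blast
    then have "\<alpha> + g \<bullet> (x - a) + c * ?n\<^sup>2 \<le> r" using h[of x] by simp
    moreover have "- (norm g * ?n) \<le> g \<bullet> (x - a)"
      using Cauchy_Schwarz_ineq2[of g "x - a"] by linarith
    moreover have "norm g * ?n \<le> c / 2 * ?n\<^sup>2 + (norm g)\<^sup>2 / (2 * c)"
    proof -
      have "0 \<le> (c * ?n - norm g)\<^sup>2 / (2 * c)" using c by simp
      also have "\<dots> = c / 2 * ?n\<^sup>2 + (norm g)\<^sup>2 / (2 * c) - norm g * ?n"
        using c by (simp add: field_simps power2_eq_square)
      finally show ?thesis by simp
    qed
    ultimately show ?thesis unfolding K_def by simp
  qed
  have "- K \<le> r" if r: "r \<in> A" for r
  proof -
    obtain x where "F x \<le> ereal (r - h x)" using r by (auto simp: A_def)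
    from growth[OF this] have "0 \<le> r + K" using c by (smt (verit) mult_nonneg_nonneg half_gt_zero zero_le_power2)
    then show ?thesis by simp
  qed
  then have bdd: "bdd_below A" by (intro bdd_belowI)
  obtain u b where u: "F u = ereal b" using closed_proper_convex_finite_point F .
  have "b + h u \<in> A" using u by (auto simp: A_def intro!: exI[of _ u])
  then have ne: "A \<noteq> {}" by auto
  have "\<exists>r\<in>A. r < Inf A + 1 / Suc n" for n
    using cInf_less_iff[OF ne bdd, of "Inf A + 1 / Suc n"] by simp
  then obtain r where r: "\<And>n. r n \<in> A" "\<And>n. r n < Inf A + 1 / Suc n" by metis
  have "(\<lambda>n. Inf A + 1 / Suc n) \<longlonglongrightarrow> Inf A + 0"
    by (intro tendsto_intros LIMSEQ_Suc[OF lim_1_over_n])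
  then have r_lim: "r \<longlonglongrightarrow> Inf A"
    using r by (intro tendsto_sandwich[of "\<lambda>_. Inf A" r _ "\<lambda>n. Inf A + 1 / Suc n"])
      (auto intro!: always_eventually less_imp_le cInf_lower[OF _ bdd])
  have "\<forall>n. \<exists>x. F x \<le> ereal (r n - h x)" using r(1) by (simp add: A_def)
  then obtain x where x: "\<And>n. F (x n) \<le> ereal (r n - h (x n))" by metis
  have "norm (x n) \<le> norm a + sqrt ((Inf A + 1 + K) * 2 / c)" for n
  proof -
    have "r n \<le> Inf A + 1" using r(2)[of n] by (smt (verit) divide_le_eq_1_pos of_nat_0_less_iff of_nat_1 of_nat_mono Suc_leI zero_less_Suc One_nat_def)
    with growth[OF x, of n] have "c / 2 * (norm (x n - a))\<^sup>2 \<le> Inf A + 1 + K" by simp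
    then have "(norm (x n - a))\<^sup>2 \<le> (Inf A + 1 + K) * 2 / c" using c by (simp add: field_simps)
    then have "norm (x n - a) \<le> sqrt ((Inf A + 1 + K) * 2 / c)" by (rule real_le_rsqrt)
    then show ?thesis using norm_triangle_sub[of "x n" a] by simp
  qed
  then have "bounded (range x)" by (auto intro!: boundedI)
  then obtain y s where s: "strict_mono s" and y: "(x \<circ> s) \<longlonglongrightarrow> y"
    using bounded_imp_convergent_subsequence by blast
  have "F y \<le> ereal (Inf A - h y)"
  proof (rule closed_proper_convex_limit[OF F y])
    show "(\<lambda>n. r (s n) - h ((x \<circ> s) n)) \<longlonglongrightarrow> Inf A - h y"
      using LIMSEQ_subseq_LIMSEQ[OF r_lim s] continuous_on_tendsto_compose[OF cont y]
      by (intro tendsto_diff) (auto simp: o_def)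
  qed (use x in auto)
  then have "F y + ereal (h y) \<le> F u + ereal (h u)" for u
  proof (cases "F u")
    case (real b)
    then have "b + h u \<in> A" by (auto simp: A_def intro!: exI[of _ u])
    then have "Inf A \<le> b + h u" by (rule cInf_lower[OF _ bdd])
    with \<open>F y \<le> _\<close> real show ?thesis by (cases "F y") auto
  qed (use nm in auto)
  then show thesis by (rule that)
qed

section \<open>Inexact relaxed Douglas-Rachford splitting\<close>

lemma orthogonal_comp_inner:
  assumes "x \<in> L" and "y \<in> L\<^sup>\<bottom>"
  shows "x \<bullet> y = 0" and "y \<bullet> x = 0"
  using assms by (auto simp: orthogonal_comp_def orthogonal_def inner_commute)

text \<open>Subtracting the partial sums of \<open>e\<close> leaves a decreasing sequence, bounded
  below because convergent partial sums are bounded.\<close>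

lemma bounded_sums_quasi_decreasing_convergent:
  fixes a e :: "nat \<Rightarrow> real"
  assumes "\<And>n. 0 \<le> a n" and "\<And>n. a (Suc n) \<le> a n + e n" and e: "summable e"
  shows "convergent a"
proof -
  define b where "b n = a n - (\<Sum>j<n. e j)" for n
  obtain K where K: "\<And>n. \<bar>\<Sum>j<n. e j\<bar> \<le> K"
    using convergent_imp_Bseq[OF e[unfolded summable_iff_convergent]] by (auto simp: Bseq_def)
  have "decseq b" unfolding b_def by (rule decseq_SucI) (use assms(2) in \<open>simp add: algebra_simps\<close>)
  moreover have "- K \<le> b n" for n
    using K[of n] assms(1)[of n] by (simp add: b_def abs_le_iff)
  ultimately have "convergent b"
    by (metis convergent_def decseq_convergent)
  moreover have "a = (\<lambda>n. b n + (\<Sum>j<n. e j))" by (simp add: b_def)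
  ultimately show ?thesis
    using convergent_add summable_iff_convergent e by metis
qed

text \<open>\<open>Q\<close> is the negative of a monotone relation: \<open>- u\<close> is a value
  at \<open>q\<close>. Hence the reversed sign in \<open>Q_mono\<close>.\<close>

locale splitting =
  fixes L :: "'a::euclidean_space set" and Q :: "('a \<times> 'a) set"
  assumes L: "subspace L"
    and Q_mono: "\<And>q u q' u'. (q, u) \<in> Q \<Longrightarrow> (q', u') \<in> Q \<Longrightarrow> (q - q') \<bullet> (u - u') \<le> 0"
    and Q_closed: "closed Q"
begin

text \<open>A pair \<open>Z \<in> L\<close>, \<open>W \<in> L\<^sup>\<bottom>\<close> encodes the point \<open>Z + W\<close>; \<open>u\<close> is the resolvent of \<open>Q\<close> at the
  reflected point \<open>Z - W\<close>. The Douglas-Rachford operator maps \<open>Z + W\<close> to \<open>W + u\<close>, so its fixed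
  points are the states with \<open>u = Z\<close>.\<close>

definition state :: "'a \<Rightarrow> 'a \<Rightarrow> 'a \<Rightarrow> bool" where
  "state Z W u \<longleftrightarrow> Z \<in> L \<and> W \<in> L\<^sup>\<bottom> \<and> (W + u - Z, u) \<in> Q"

text \<open>Firm nonexpansiveness of the Douglas-Rachford operator: \<open>u - Z\<close> is the
  displacement from \<open>Z + W\<close> to its image \<open>W + u\<close>. The product equals the
  monotonicity term of \<open>Q\<close> minus \<open>(Z - Z') \<bullet> (W - W')\<close>, which
  vanishes by orthogonality.\<close>

lemma state_firm:
  assumes "state Z W u" and "state Z' W' u'"
  shows "((u - Z) - (u' - Z')) \<bullet> ((W + u) - (W' + u')) \<le> 0"
proof -
  have "(W + u - Z - (W' + u' - Z')) \<bullet> (u - u') \<le> 0"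
    using assms Q_mono by (auto simp: state_def)
  moreover have "(Z - Z') \<bullet> (W - W') = 0"
    using assms L subspace_orthogonal_comp[of L]
    by (intro orthogonal_comp_inner[of _ L]) (auto simp: state_def subspace_diff)
  ultimately show ?thesis by (simp add: inner_simps inner_commute)
qed

lemma state_nonexpansive:
  assumes "state Z W u" and "state Z' W' u'"
  shows "norm ((W + u) - (W' + u')) \<le> norm ((Z + W) - (Z' + W'))"
proof (rule power2_le_imp_le)
  let ?d = "(u - Z) - (u' - Z')" and ?g = "(W + u) - (W' + u')"
  have expand: "(norm (g - d))\<^sup>2 = (norm g)\<^sup>2 - 2 * (d \<bullet> g) + (norm d)\<^sup>2" for g d :: 'a
    by (simp only: power2_norm_eq_inner) (simp add: inner_diff inner_commute)
  have "(norm ((Z + W) - (Z' + W')))\<^sup>2 = (norm (?g - ?d))\<^sup>2" by (simp add: algebra_simps)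
  also have "\<dots> = (norm ?g)\<^sup>2 - 2 * (?d \<bullet> ?g) + (norm ?d)\<^sup>2" by (rule expand)
  finally show "(norm ?g)\<^sup>2 \<le> (norm ((Z + W) - (Z' + W')))\<^sup>2"
    using state_firm[OF assms] zero_le_power2[of "norm ?d"] by linarith
qed simp

text \<open>Expansion of the square for a step of length \<open>n\<close> along the displacement
  \<open>d\<close>. Slack \<open>c = 0\<close> serves fixed points and gives Fejer monotonicity;
  positive \<open>c\<close> serves fixed points of the contracted operator and gives a decrease that
  does not fade.\<close>

lemma relaxed_step:
  fixes s d y :: 'a
  assumes "d \<bullet> (s + d - y) \<le> - c" and "0 \<le> n"
  shows "(norm (s + n *\<^sub>R d - y))\<^sup>2 \<le> (norm (s - y))\<^sup>2 - n * (2 - n) * (norm d)\<^sup>2 - 2 * n * c"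
proof -
  have "(norm (s + n *\<^sub>R d - y))\<^sup>2 = (norm ((s - y) + n *\<^sub>R d))\<^sup>2" by (simp add: algebra_simps)
  also have "\<dots> = (norm (s - y))\<^sup>2 + 2 * n * (d \<bullet> (s - y)) + n * n * (norm d)\<^sup>2"
    by (simp add: norm_add_scaleR_squared inner_commute)
  also have "d \<bullet> (s - y) = d \<bullet> (s + d - y) - (norm d)\<^sup>2"
    by (simp only: power2_norm_eq_inner) (simp add: inner_simps)
  finally show ?thesis
    using mult_left_mono[OF assms] by (simp add: algebra_simps)
qed

end

text \<open>\<open>U\<close> holds the exact resolvent points, \<open>V\<close> the computed ones
  that drive the recursion. \<open>step\<close> can prescribe the sum alone, since membership in
  \<open>L\<close> and \<open>L\<^sup>\<bottom>\<close> determines both parts.\<close>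

locale splitting_sequence = splitting L Q
  for L :: "'a::euclidean_space set" and Q +
  fixes Z W U V :: "nat \<Rightarrow> 'a" and \<nu> \<epsilon> :: "nat \<Rightarrow> real" and a b :: real
  assumes states: "\<And>k. state (Z k) (W k) (U k)"
    and step: "\<And>k. Z (Suc k) + W (Suc k) = Z k + W k + \<nu> k *\<^sub>R (V k - Z k)"
    and err: "\<And>k. norm (V k - U k) \<le> \<epsilon> k" and eps: "summable \<epsilon>"
    and relax: "0 < a" "\<And>k. a \<le> \<nu> k" "\<And>k. \<nu> k \<le> b" "b < 2"
begin

section \<open>Quasi-Fejer monotonicity and convergence of the inexact iterates\<close>

abbreviation "S k \<equiv> Z k + W k"
abbreviation "d k \<equiv> U k - Z k"
abbreviation "exact k \<equiv> S k + \<nu> k *\<^sub>R d k"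

lemma nu_pos: "0 < \<nu> k"
  using relax(1) relax(2)[of k] by linarith

lemma inexact: "norm (S (Suc k) - exact k) \<le> 2 * \<epsilon> k"
proof -
  have "S (Suc k) - exact k = \<nu> k *\<^sub>R (V k - U k)"
    unfolding step by (simp add: algebra_simps)
  then have "norm (S (Suc k) - exact k) = \<nu> k * norm (V k - U k)" using nu_pos[of k] by simp
  \<comment> \<open>The factor 2 bounds the relaxation parameter, as
    \<open>\<nu> k \<le> b < 2\<close>.\<close>
  also have "\<dots> \<le> 2 * \<epsilon> k"
    using relax(3)[of k] relax(4) nu_pos[of k] err[of k] by (intro mult_mono) auto
  finally show ?thesis .
qed

lemma eps_lim: "\<epsilon> \<longlonglongrightarrow> 0"
  using eps by (rule summable_LIMSEQ_zero)

lemma exact_le: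
  assumes "state Z' W' Z'"
  shows "(norm (exact k - (Z' + W')))\<^sup>2 \<le> (norm (S k - (Z' + W')))\<^sup>2 - a * (2 - b) * (norm (d k))\<^sup>2"
proof -
  have "d k \<bullet> (S k + d k - (Z' + W')) \<le> - 0"
    using state_firm[OF states[of k] assms] by (simp add: algebra_simps)
  from relaxed_step[OF this, of "\<nu> k"] nu_pos[of k]
  have "(norm (exact k - (Z' + W')))\<^sup>2 \<le> (norm (S k - (Z' + W')))\<^sup>2 - \<nu> k * (2 - \<nu> k) * (norm (d k))\<^sup>2"
    by simp
  moreover have "a * (2 - b) \<le> \<nu> k * (2 - \<nu> k)"
    using relax(1,4) relax(2)[of k] relax(3)[of k] by (intro mult_mono) auto
  then have "a * (2 - b) * (norm (d k))\<^sup>2 \<le> \<nu> k * (2 - \<nu> k) * (norm (d k))\<^sup>2"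
    by (rule mult_right_mono) simp
  ultimately show ?thesis by linarith
qed

lemma relax_margin: "0 < a * (2 - b)"
  using relax by simp

lemma fejer:
  assumes "state Z' W' Z'"
  shows "norm (exact k - (Z' + W')) \<le> norm (S k - (Z' + W'))"
    and "norm (S (Suc k) - (Z' + W')) \<le> norm (exact k - (Z' + W')) + 2 * \<epsilon> k"
proof -
  have "0 \<le> a * (2 - b) * (norm (d k))\<^sup>2" using relax_margin by simp
  then have "(norm (exact k - (Z' + W')))\<^sup>2 \<le> (norm (S k - (Z' + W')))\<^sup>2"
    using exact_le[OF assms, of k] by linarith
  then show "norm (exact k - (Z' + W')) \<le> norm (S k - (Z' + W'))"
    by (rule power2_le_imp_le) simp
  show "norm (S (Suc k) - (Z' + W')) \<le> norm (exact k - (Z' + W')) + 2 * \<epsilon> k"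
    using inexact[of k] dist_triangle[of "S (Suc k)" "Z' + W'" "exact k"] unfolding dist_norm by linarith
qed

lemma distance_convergent:
  assumes "state Z' W' Z'"
  shows "convergent (\<lambda>k. norm (S k - (Z' + W')))"
proof (rule bounded_sums_quasi_decreasing_convergent)
  show "norm (S (Suc n) - (Z' + W')) \<le> norm (S n - (Z' + W')) + 2 * \<epsilon> n" for n
    using fejer[OF assms, of n] by linarith
qed (use eps in \<open>auto intro: summable_mult\<close>)

text \<open>The distance after an exact step is squeezed between consecutive distances of the
  iterates up to \<open>2 * \<epsilon> k\<close>, so the squared decrease vanishes; it dominates a
  fixed positive multiple of \<open>(norm (d k))\<^sup>2\<close>.\<close>

lemma residual_lim:
  assumes "state Z' W' Z'"
  shows "d \<longlonglongrightarrow> 0"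
proof -
  let ?y = "Z' + W'"
  obtain l where l: "(\<lambda>k. norm (S k - ?y)) \<longlonglongrightarrow> l"
    using distance_convergent[OF assms] by (auto simp: convergent_def)
  have "(\<lambda>k. norm (exact k - ?y)) \<longlonglongrightarrow> l"
  proof (rule tendsto_sandwich)
    show "(\<lambda>k. norm (S (Suc k) - ?y) - 2 * \<epsilon> k) \<longlonglongrightarrow> l"
      using tendsto_diff[OF LIMSEQ_Suc[OF l] tendsto_mult_left[OF eps_lim, of 2]] by simp
    show "\<forall>\<^sub>F k in sequentially. norm (exact k - ?y) \<le> norm (S k - ?y)"
      using fejer(1)[OF assms] by simp
    show "\<forall>\<^sub>F k in sequentially. norm (S (Suc k) - ?y) - 2 * \<epsilon> k \<le> norm (exact k - ?y)"
      using fejer(2)[OF assms] by (simp add: diff_le_eq)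
  qed (rule l)
  then have "(\<lambda>k. (norm (S k - ?y))\<^sup>2 - (norm (exact k - ?y))\<^sup>2) \<longlonglongrightarrow> l\<^sup>2 - l\<^sup>2"
    by (intro tendsto_intros l)
  then have lim: "(\<lambda>k. ((norm (S k - ?y))\<^sup>2 - (norm (exact k - ?y))\<^sup>2) / (a * (2 - b))) \<longlonglongrightarrow> 0"
    using tendsto_divide[OF _ tendsto_const[of "a * (2 - b)"]] relax_margin by fastforce
  have "(\<lambda>k. (norm (d k))\<^sup>2) \<longlonglongrightarrow> 0"
  proof (rule tendsto_sandwich[OF _ _ tendsto_const lim])
    show "\<forall>\<^sub>F k in sequentially. (norm (d k))\<^sup>2 \<le> ((norm (S k - ?y))\<^sup>2 - (norm (exact k - ?y))\<^sup>2) / (a * (2 - b))"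
      using exact_le[OF assms] relax_margin by (intro always_eventually allI) (simp add: pos_le_divide_eq mult.commute algebra_simps)
  qed simp
  then have "(\<lambda>k. sqrt ((norm (d k))\<^sup>2)) \<longlonglongrightarrow> sqrt 0" by (rule tendsto_real_sqrt)
  then show ?thesis by (simp add: tendsto_norm_zero_iff)
qed

lemma closed_L: "closed L" and closed_orthogonal_comp_L: "closed (L\<^sup>\<bottom>)"
  using L subspace_orthogonal_comp closed_subspace by auto

lemma norm_parts_le:
  assumes "z \<in> L" and "w \<in> L\<^sup>\<bottom>"
  shows "norm z \<le> norm (z + w)" and "norm w \<le> norm (z + w)"
proof -
  have "(norm (z + w))\<^sup>2 = (norm z)\<^sup>2 + (norm w)\<^sup>2"
    using orthogonal_comp_inner[OF assms]
    by (simp add: power2_norm_eq_inner inner_simps)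
  then have "(norm z)\<^sup>2 \<le> (norm (z + w))\<^sup>2" and "(norm w)\<^sup>2 \<le> (norm (z + w))\<^sup>2" by simp_all
  then show "norm z \<le> norm (z + w)" and "norm w \<le> norm (z + w)"
    by (metis norm_ge_zero power2_le_imp_le)+
qed

text \<open>Opial's argument: a cluster point of the bounded iterates is itself a fixed point, as
  \<open>Q\<close> is closed and the residual vanishes. Its distance to the iterates converges and
  tends to 0 along a subsequence, hence tends to 0.\<close>

theorem convergence:
  assumes "\<exists>Z' W'. state Z' W' Z'"
  obtains Z' W' where "state Z' W' Z'" and "Z \<longlonglongrightarrow> Z'" and "W \<longlonglongrightarrow> W'"
    and "U \<longlonglongrightarrow> Z'" and "V \<longlonglongrightarrow> Z'"
proof -
  obtain Z0 W0 where zero: "state Z0 W0 Z0" using assms by blast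
  have d: "d \<longlonglongrightarrow> 0" by (rule residual_lim[OF zero])
  obtain K where K: "\<And>k. norm (S k - (Z0 + W0)) \<le> K"
    using convergent_imp_Bseq[OF distance_convergent[OF zero]] by (auto simp: Bseq_def)
  have "norm (S k) \<le> K + norm (Z0 + W0)" for k
    using K[of k] norm_triangle_ineq[of "S k - (Z0 + W0)" "Z0 + W0"] by simp
  then have K': "norm (Z k) \<le> K + norm (Z0 + W0)" "norm (W k) \<le> K + norm (Z0 + W0)" for k
    using norm_parts_le[of "Z k" "W k"] states[of k] unfolding state_def by (meson order_trans)+
  have "norm (Z k, W k) \<le> (K + norm (Z0 + W0)) + (K + norm (Z0 + W0))" for k
    using norm_Pair_le[of "Z k" "W k"] K'[of k] by linarith
  then have "bounded (range (\<lambda>k. (Z k, W k)))" by (auto intro!: boundedI)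
  then obtain l r where r: "strict_mono r" and l: "((\<lambda>k. (Z k, W k)) \<circ> r) \<longlonglongrightarrow> l"
    using bounded_imp_convergent_subsequence by blast
  define Z' W' where "Z' = fst l" and "W' = snd l"
  have Zr: "(\<lambda>k. Z (r k)) \<longlonglongrightarrow> Z'" and Wr: "(\<lambda>k. W (r k)) \<longlonglongrightarrow> W'"
    using tendsto_fst[OF l] tendsto_snd[OF l] by (auto simp: Z'_def W'_def)
  have dr: "(\<lambda>k. d (r k)) \<longlonglongrightarrow> 0"
    using LIMSEQ_subseq_LIMSEQ[OF d r] by (simp add: o_def)
  have st: "state Z' W' Z'"
    unfolding state_def
  proof (intro conjI)
    show "Z' \<in> L" by (rule closed_sequentially[OF closed_L _ Zr]) (use states in \<open>simp add: state_def\<close>)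
    show "W' \<in> L\<^sup>\<bottom>" by (rule closed_sequentially[OF closed_orthogonal_comp_L _ Wr]) (use states in \<open>simp add: state_def\<close>)
    have "(\<lambda>k. (W (r k) + d (r k), Z (r k) + d (r k))) \<longlonglongrightarrow> (W' + 0, Z' + 0)"
      by (intro tendsto_intros Zr Wr dr)
    moreover have "(W (r k) + d (r k), Z (r k) + d (r k)) \<in> Q" for k
      using states[of "r k"] by (simp add: state_def add_diff_eq)
    ultimately show "(W' + Z' - Z', Z') \<in> Q"
      using closed_sequentially[OF Q_closed] by fastforce
  qed
  obtain m where m: "(\<lambda>k. norm (S k - (Z' + W'))) \<longlonglongrightarrow> m"
    using distance_convergent[OF st] by (auto simp: convergent_def)
  have "(\<lambda>k. norm (S (r k) - (Z' + W'))) \<longlonglongrightarrow> norm (Z' + W' - (Z' + W'))"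
    by (intro tendsto_intros Zr Wr)
  then have "m = 0"
    using LIMSEQ_unique LIMSEQ_subseq_LIMSEQ[OF m r] by (fastforce simp: o_def)
  with m have lim: "(\<lambda>k. norm (S k - (Z' + W'))) \<longlonglongrightarrow> 0" by simp
  have parts: "norm (Z k - Z') \<le> norm (S k - (Z' + W'))" "norm (W k - W') \<le> norm (S k - (Z' + W'))" for k
    using norm_parts_le[of "Z k - Z'" "W k - W'"] states[of k] st L subspace_orthogonal_comp[of L]
    by (auto simp: state_def subspace_diff algebra_simps)
  have "Z \<longlonglongrightarrow> Z'" "W \<longlonglongrightarrow> W'"
    by (intro LIM_zero_cancel[OF Lim_null_comparison[OF _ lim]] always_eventually allI parts)+
  moreover have "(\<lambda>k. V k - U k) \<longlonglongrightarrow> 0"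
    by (rule Lim_null_comparison[OF _ eps_lim]) (use err in simp)
  moreover have "U \<longlonglongrightarrow> Z'" using tendsto_add[OF d \<open>Z \<longlonglongrightarrow> Z'\<close>] by simp
  ultimately have "V \<longlonglongrightarrow> Z'" using tendsto_add[of "\<lambda>k. V k - U k" 0 _ U Z'] by simp
  with st \<open>Z \<longlonglongrightarrow> Z'\<close> \<open>W \<longlonglongrightarrow> W'\<close> \<open>U \<longlonglongrightarrow> Z'\<close> show thesis by (intro that)
qed

text \<open>Iterates staying in a ball of radius \<open>R\<close> cannot move towards a point \<open>y\<close> with
  \<open>- e *\<^sub>R y\<close> in the splitting operator at \<open>y\<close> forever, so \<open>y\<close> lies in that ball.\<close>

lemma regularized_zero_bounded:
  assumes R: "\<And>k. norm (S k) \<le> R" "\<And>k. norm (W k + U k) \<le> R"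
    and e: "0 < e" and st: "state Z' W' u'" and y: "y = W' + u'" "Z' + W' = (1 - e) *\<^sub>R y"
  shows "norm y \<le> R"
proof (rule ccontr)
  assume "\<not> norm y \<le> R"
  then have gt: "R < norm y" by simp
  have R0: "0 \<le> R" using order_trans[OF norm_ge_zero R(1)[of 0]] .
  \<comment> \<open>By Cauchy-Schwarz and \<open>norm (W k + U k) \<le> R\<close>,
    \<open>- c\<close> bounds \<open>e * (y \<bullet> (W k + U k)) - e * (y \<bullet> y)\<close>
    from above; \<open>c\<close> is positive because \<open>y\<close> lies outside the ball.\<close>
  define c where "c = e * norm y * (norm y - R)"
  have c: "0 < c" unfolding c_def using e gt R0 by (intro mult_pos_pos) auto
  define A where "A k = (norm (S k - y))\<^sup>2" for k
  define K where "K = 4 * (R + norm y)"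
  have u': "u' - Z' = e *\<^sub>R y" using y by (simp add: algebra_simps)
  have decr: "A (Suc k) \<le> A k - 2 * a * c + (K + 4 * \<epsilon> k) * \<epsilon> k" for k
  proof -
    have "(d k - e *\<^sub>R y) \<bullet> (S k + d k - y) \<le> 0"
      using state_firm[OF states[of k] st] unfolding u' y(1)[symmetric] by (simp add: add.commute)
    then have "d k \<bullet> (S k + d k - y) \<le> e * (y \<bullet> (S k + d k)) - e * (y \<bullet> y)"
      by (simp add: inner_simps algebra_simps)
    moreover have "y \<bullet> (S k + d k) \<le> norm y * R"
      using norm_cauchy_schwarz[of y "W k + U k"] mult_left_mono[OF R(2)[of k] norm_ge_zero[of y]]
      by (simp add: algebra_simps)
    then have "e * (y \<bullet> (S k + d k)) \<le> e * (norm y * R)" using e by simp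
    moreover have "y \<bullet> y = norm y * norm y" by (simp add: dot_square_norm power2_eq_square)
    ultimately have "d k \<bullet> (S k + d k - y) \<le> - c" unfolding c_def by (simp add: algebra_simps)
    from relaxed_step[OF this, of "\<nu> k"] nu_pos[of k]
    have "(norm (exact k - y))\<^sup>2 \<le> A k - \<nu> k * (2 - \<nu> k) * (norm (d k))\<^sup>2 - 2 * \<nu> k * c"
      by (simp add: A_def)
    moreover have "0 \<le> \<nu> k * (2 - \<nu> k) * (norm (d k))\<^sup>2"
      using nu_pos[of k] relax(3)[of k] relax(4) by simp
    moreover have "2 * a * c \<le> 2 * \<nu> k * c" using relax(2)[of k] c by simp
    ultimately have ex: "(norm (exact k - y))\<^sup>2 \<le> A k - 2 * a * c" by linarith
    also have "\<dots> \<le> A k" using c relax(1) by simp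
    finally have "norm (exact k - y) \<le> norm (S k - y)"
      unfolding A_def by (rule power2_le_imp_le) simp
    also have "\<dots> \<le> R + norm y" using norm_triangle_ineq4[of "S k" y] R(1)[of k] by simp
    finally have b: "norm (exact k - y) \<le> R + norm y" .
    have e0: "0 \<le> \<epsilon> k" using order_trans[OF norm_ge_zero err[of k]] .
    have "norm (S (Suc k) - y) \<le> norm (exact k - y) + 2 * \<epsilon> k"
      using inexact[of k] norm_triangle_ineq[of "S (Suc k) - exact k" "exact k - y"] by simp
    then have "A (Suc k) \<le> (norm (exact k - y) + 2 * \<epsilon> k)\<^sup>2"
      unfolding A_def by (intro power_mono) auto
    also have "\<dots> = (norm (exact k - y))\<^sup>2 + 4 * norm (exact k - y) * \<epsilon> k + 4 * \<epsilon> k * \<epsilon> k"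
      by (simp add: power2_eq_square algebra_simps)
    also have "4 * norm (exact k - y) * \<epsilon> k \<le> K * \<epsilon> k"
      unfolding K_def using b e0 by (intro mult_right_mono) auto
    finally show ?thesis using ex by (simp add: algebra_simps)
  qed
  \<comment> \<open>Once the error terms fall below \<open>a * c\<close>, each step lowers the
    squared distance by at least \<open>2 * a * c - a * c\<close>, which cannot go on
    forever.\<close>
  have "(\<lambda>k. (K + 4 * \<epsilon> k) * \<epsilon> k) \<longlonglongrightarrow> (K + 4 * 0) * 0"
    by (intro tendsto_intros eps_lim)
  then have "\<forall>\<^sub>F k in sequentially. (K + 4 * \<epsilon> k) * \<epsilon> k < a * c"
    using order_tendstoD(2) c relax(1) by fastforce
  then obtain N where N: "\<And>k. k \<ge> N \<Longrightarrow> (K + 4 * \<epsilon> k) * \<epsilon> k < a * c"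
    by (auto simp: eventually_sequentially)
  have "A (N + k) \<le> A N - k * (a * c)" for k
  proof (induction k)
    case (Suc k)
    then show ?case using decr[of "N + k"] N[of "N + k"] by (simp add: algebra_simps)
  qed simp
  moreover obtain k :: nat where "A N < k * (a * c)"
    using ex_less_of_nat_mult[of "a * c" "A N"] c relax(1) by auto
  ultimately have "A (N + k) < 0" by (smt (verit))
  then show False by (simp add: A_def)
qed

text \<open>Consecutive states differ by \<open>\<nu> k *\<^sub>R (V k - Z k)\<close> with
  \<open>\<nu> k \<ge> a\<close>, so bounded states bound \<open>V\<close>, and \<open>U\<close>
  stays within a bounded error of \<open>V\<close>.\<close>

lemma bounded_exact_iterates:
  assumes "bounded (range Z)" "bounded (range W)"
  shows "bounded (range U)"
proof -
  obtain R1 R2 where R: "\<And>k. norm (Z k) \<le> R1" "\<And>k. norm (W k) \<le> R2"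
    using assms by (auto simp: bounded_iff)
  obtain K where K: "\<And>k. \<bar>\<epsilon> k\<bar> \<le> K"
    using convergent_imp_Bseq[OF convergentI[OF eps_lim]] by (auto simp: Bseq_def)
  have "norm (U k) \<le> K + 2 * (R1 + R2) / a + R1" for k
  proof -
    have S: "norm (S j) \<le> R1 + R2" for j
      using norm_triangle_ineq[of "Z j" "W j"] R(1)[of j] R(2)[of j] by linarith
    have "a * norm (V k - Z k) \<le> \<nu> k * norm (V k - Z k)"
      by (intro mult_right_mono relax) simp
    also have "\<dots> = norm (S (Suc k) - S k)"
      unfolding step using nu_pos[of k] by simp
    also have "\<dots> \<le> (R1 + R2) + (R1 + R2)"
      by (rule order_trans[OF norm_triangle_ineq4]) (intro add_mono S)
    also have "\<dots> = 2 * (R1 + R2)" by simp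
    finally have "norm (V k - Z k) \<le> 2 * (R1 + R2) / a"
      using relax(1) by (simp add: pos_le_divide_eq mult.commute)
    moreover have "norm (V k - U k) \<le> K" using err[of k] K[of k] by linarith
    moreover have "norm (U k) \<le> norm (V k - U k) + norm (V k - Z k) + norm (Z k)"
      using norm_triangle_ineq4[of "V k" "V k - U k"] norm_triangle_ineq[of "V k - Z k" "Z k"] by simp
    ultimately show ?thesis using R(1)[of k] by linarith
  qed
  then show ?thesis by (auto intro: boundedI)
qed

text \<open>\<open>minty\<close> provides a resolvent value at every reflected point, so the
  splitting operator is a nonexpansive map \<open>g\<close> on the whole space and its contracted
  versions have fixed points; \<open>regularized_zero_bounded\<close> confines these to one
  ball.\<close>

theorem bounded_imp_zero:
  assumes bnd: "bounded (range Z)" "bounded (range W)"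
    and minty: "\<And>p. \<exists>u. (u - p, u) \<in> Q"
  shows "\<exists>Z' W'. state Z' W' Z'"
proof -
  obtain R1 R2 R3 where R123: "\<And>k. norm (Z k) \<le> R1" "\<And>k. norm (W k) \<le> R2" "\<And>k. norm (U k) \<le> R3"
    using bnd bounded_exact_iterates[OF bnd] by (auto simp: bounded_iff)
  define R where "R = max (R1 + R2) (R2 + R3)"
  have R: "norm (S k) \<le> R" "norm (W k + U k) \<le> R" for k
    using norm_triangle_ineq[of "Z k" "W k"] norm_triangle_ineq[of "W k" "U k"]
      R123(1)[of k] R123(2)[of k] R123(3)[of k] unfolding R_def by linarith+
  have "\<exists>g Z' W' u'. s = Z' + W' \<and> state Z' W' u' \<and> g = W' + u'" for s
  proof -
    obtain Z' W' where Z': "Z' \<in> span L" "\<And>w. w \<in> span L \<Longrightarrow> orthogonal W' w" "s = Z' + W'"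
      using orthogonal_subspace_decomp_exists[of L s] by metis
    moreover have "span L = L" using L by simp
    ultimately have "Z' \<in> L" "W' \<in> L\<^sup>\<bottom>"
      by (auto simp: orthogonal_comp_def orthogonal_commute)
    moreover obtain u' where "(u' - (Z' - W'), u') \<in> Q" using minty by blast
    ultimately have "state Z' W' u'" by (simp add: state_def algebra_simps)
    with Z' show ?thesis by blast
  qed
  then obtain g where g: "\<And>s. \<exists>Z' W' u'. s = Z' + W' \<and> state Z' W' u' \<and> g s = W' + u'"
    by metis
  have ne: "norm (g s - g t) \<le> norm (s - t)" for s t
    using g[of s] g[of t] state_nonexpansive by metis
  have "\<exists>y. g ((1 - e) *\<^sub>R y) = y" if e: "0 < e" "e < 1" for e
  proof -
    have "dist (g ((1 - e) *\<^sub>R x)) (g ((1 - e) *\<^sub>R y)) \<le> (1 - e) * dist x y" for x y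
    proof -
      have "norm ((1 - e) *\<^sub>R x - (1 - e) *\<^sub>R y) = (1 - e) * norm (x - y)"
        using e by (simp flip: scaleR_diff_right)
      then show ?thesis using ne[of "(1 - e) *\<^sub>R x" "(1 - e) *\<^sub>R y"] by (simp add: dist_norm)
    qed
    then show ?thesis
      using banach_fix_type[of "1 - e" "\<lambda>y. g ((1 - e) *\<^sub>R y)"] e by auto
  qed
  \<comment> \<open>The offset 2 keeps the contraction parameter strictly between 0 and 1 already
    for \<open>n = 0\<close>.\<close>
  then have "\<exists>y. g ((1 - 1 / real (n + 2)) *\<^sub>R y) = y" for n by simp
  then obtain y where y: "\<And>n. g ((1 - 1 / real (n + 2)) *\<^sub>R y n) = y n" by metis
  have yR: "norm (y n) \<le> R" for n
  proof -
    obtain Z' W' u' where "(1 - 1 / real (n + 2)) *\<^sub>R y n = Z' + W'" "state Z' W' u'" "y n = W' + u'"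
      using g y by metis
    from regularized_zero_bounded[OF R _ this(2,3) this(1)[symmetric]]
    show ?thesis by simp
  qed
  then have "bounded (range y)" by (auto intro!: boundedI)
  then obtain l r where r: "strict_mono r" and l: "(y \<circ> r) \<longlonglongrightarrow> l"
    using bounded_imp_convergent_subsequence by blast
  have "(\<lambda>n. 1 / real (n + 2)) \<longlonglongrightarrow> 0"
    using LIMSEQ_ignore_initial_segment[OF lim_1_over_n, of 2] by simp
  from LIMSEQ_subseq_LIMSEQ[OF this r]
  have "(\<lambda>n. (1 - 1 / real (r n + 2)) *\<^sub>R (y \<circ> r) n) \<longlonglongrightarrow> (1 - 0) *\<^sub>R l"
    by (intro tendsto_intros l) (simp add: o_def)
  then have lim: "(\<lambda>n. norm ((1 - 1 / real (r n + 2)) *\<^sub>R (y \<circ> r) n - l)) \<longlonglongrightarrow> 0"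
    by (simp add: tendsto_norm_zero_iff LIM_zero_iff)
  \<comment> \<open>\<open>y (r n)\<close> is the image under \<open>g\<close> of its shrunken copy,
    and these copies also tend to \<open>l\<close>, so nonexpansiveness carries the limit through
    \<open>g\<close>.\<close>
  have "(y \<circ> r) \<longlonglongrightarrow> g l"
  proof (rule LIM_zero_cancel[OF Lim_null_comparison[OF _ lim]], rule always_eventually, rule allI)
    fix n
    show "norm ((y \<circ> r) n - g l) \<le> norm ((1 - 1 / real (r n + 2)) *\<^sub>R (y \<circ> r) n - l)"
      using ne[of "(1 - 1 / real (r n + 2)) *\<^sub>R y (r n)" l] y[of "r n"] by simp
  qed
  with l have "g l = l" using LIMSEQ_unique by blast
  with g[of l] obtain Z' W' u' where "state Z' W' u'" "Z' + W' = W' + u'" by metis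
  then have "state Z' W' Z'" by (simp add: add.commute)
  then show ?thesis by blast
qed

end

section \<open>Nonanticipative subspaces of a scenario tree\<close>

lemma scenario_tree_path_stage:
  assumes "is_scenario_tree T G" and "(N, C) \<in> (edges G)\<^sup>*"
  shows "stage G N \<le> stage G C \<and> (stage G N = stage G C \<longrightarrow> N = C)"
  using assms(2)
proof (induction rule: rtrancl_induct)
  case (step B C)
  then have "stage G C = Suc (stage G B)"
    using assms(1) by (auto simp: is_scenario_tree_def)
  with step show ?case by auto
qed simp

lemma scenario_tree_ancestor_unique:
  assumes tree: "is_scenario_tree T G"
    and "(N, C) \<in> (edges G)\<^sup>*" and "(N', C) \<in> (edges G)\<^sup>*" and "stage G N = stage G N'"
  shows "N = N'"
  using assms(2,3,4)
proof (induction rule: rtrancl_induct)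
  case base
  then show ?case using scenario_tree_path_stage[OF tree, of N' N] by simp
next
  case (step B C)
  have nodes: "B \<in> nodes G" "C \<in> nodes G" and stage: "stage G C = Suc (stage G B)"
    using tree step.hyps(2) by (auto simp: is_scenario_tree_def)
  \<comment> \<open>Stages start at 1 and \<open>C\<close> lies one above \<open>B\<close>, so
    \<open>C\<close> is not at the root stage and its parent is unique.\<close>
  then have "stage G C \<noteq> 1" using tree by (auto simp: is_scenario_tree_def image_subset_iff)
  then have unique: "\<And>D. (D, C) \<in> edges G \<Longrightarrow> D = B"
    using tree nodes step.hyps(2) unfolding is_scenario_tree_def by blast
  from \<open>(N', C) \<in> (edges G)\<^sup>*\<close> show ?case
  proof (cases rule: rtranclE)
    case base
    then show ?thesis
      using scenario_tree_path_stage[OF tree step.hyps(1)] stage step.prems by simp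
  next
    case (step D)
    then show ?thesis using unique \<open>(N', C) \<in> _\<close> step.IH step.prems by metis
  qed
qed

text \<open>Descending induction on the stage: start at the leaf and pass to parents, which exist
  for every node whose stage is not 1.\<close>

lemma scenario_tree_ancestor_exists:
  assumes tree: "is_scenario_tree T G" and "1 \<le> t" and "t \<le> T"
  shows "\<exists>N\<in>nodes G. stage G N = t \<and> i \<in> leaf_descendants G N"
  using assms(3,2)
proof (induction t rule: inc_induct)
  case base
  have "leaf G i \<in> nodes G"
    using tree by (auto simp: is_scenario_tree_def bij_betw_def)
  then show ?case
    using tree by (auto simp: is_scenario_tree_def leaf_descendants_def)
next
  case (step t)
  then obtain C where C: "C \<in> nodes G" "stage G C = Suc t" "i \<in> leaf_descendants G C"
    by auto
  then obtain N where N: "(N, C) \<in> edges G"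
    using tree step.prems unfolding is_scenario_tree_def by (metis One_nat_def Suc_inject not_one_le_zero)
  then have "N \<in> nodes G" "stage G C = Suc (stage G N)"
    using tree by (auto simp: is_scenario_tree_def)
  with C N show ?case
    by (auto simp: leaf_descendants_def intro: converse_rtrancl_into_rtrancl)
qed

lemma nonleaf_ancestor:
  assumes tree: "is_scenario_tree T G" and t: "1 \<le> t" "t < T"
  shows "\<exists>N\<in>nonleaf_nodes G. stage G N = t \<and> i \<in> leaf_descendants G N"
proof -
  obtain N where N: "N \<in> nodes G" "stage G N = t" "i \<in> leaf_descendants G N"
    using scenario_tree_ancestor_exists[OF tree, of t i] t by auto
  have "stage G (leaf G i) = T" using tree by (simp add: is_scenario_tree_def)
  then have "N \<noteq> leaf G i" using N t by auto
  then have "\<exists>C. (N, C) \<in> edges G"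
    using N(3) by (auto simp: leaf_descendants_def elim: converse_rtranclE)
  with N show ?thesis by (auto simp: nonleaf_nodes_def)
qed

text \<open>For a fixed component \<open>e\<close>, the nodes of stage \<open>\<tau> e\<close>
  partition the scenarios; on each block \<open>z\<close> is constant and the weighted sum of
  \<open>w\<close> is 0.\<close>

lemma nonant_orthogonal_nonant_star:
  fixes G :: "('n, 's::finite) scenario_tree" and \<tau> :: "'e::finite \<Rightarrow> nat"
  assumes tree: "is_scenario_tree T G" and stages: "range \<tau> = {1..<T}"
    and z: "z \<in> nonant G \<tau>" and w: "w \<in> nonant_star G \<tau> \<pi>"
  shows "(\<chi> i. \<pi> i *\<^sub>R w $ i) \<bullet> z = 0"
proof -
  have "(\<Sum>i\<in>UNIV. \<pi> i * w $ i $ e * z $ i $ e) = 0" for e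
  proof -
    have "\<tau> e \<in> {1..<T}" using stages by auto
    then have "\<forall>i. \<exists>N\<in>nonleaf_nodes G. stage G N = \<tau> e \<and> i \<in> leaf_descendants G N"
      using nonleaf_ancestor[OF tree, of "\<tau> e"] by simp
    \<comment> \<open>\<open>A i\<close> is the ancestor of scenario \<open>i\<close> at stage
      \<open>\<tau> e\<close>; its fibers are the blocks along which the sum is grouped.\<close>
    then obtain A where A: "\<And>i. A i \<in> nonleaf_nodes G" "\<And>i. stage G (A i) = \<tau> e"
        "\<And>i. i \<in> leaf_descendants G (A i)" by metis
    have D: "{i'\<in>UNIV. A i' = A i} = leaf_descendants G (A i)" for i
    proof -
      have "A i' = A i \<longleftrightarrow> i' \<in> leaf_descendants G (A i)" for i'
      proof
        show "A i' = A i \<Longrightarrow> i' \<in> leaf_descendants G (A i)" using A(3)[of i'] by simp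
        show "i' \<in> leaf_descendants G (A i) \<Longrightarrow> A i' = A i"
          using scenario_tree_ancestor_unique[OF tree, of "A i'" "leaf G i'" "A i"] A(2) A(3)[of i']
          by (simp add: leaf_descendants_def)
      qed
      then show ?thesis by blast
    qed
    have "(\<Sum>i'\<in>{i'\<in>UNIV. A i' = A i}. \<pi> i' * w $ i' $ e * z $ i' $ e) = 0" for i
    proof -
      have "(\<Sum>i'\<in>leaf_descendants G (A i). \<pi> i' * w $ i' $ e * z $ i' $ e)
          = (\<Sum>i'\<in>leaf_descendants G (A i). \<pi> i' * w $ i' $ e * z $ i $ e)"
        using z A unfolding nonant_def by (intro sum.cong refl) (simp, metis)
      also have "\<dots> = (\<Sum>i'\<in>leaf_descendants G (A i). \<pi> i' * w $ i' $ e) * z $ i $ e"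
        by (simp add: sum_distrib_right)
      also have "\<dots> = 0" using w A by (simp add: nonant_star_def)
      finally show ?thesis unfolding D .
    qed
    then have "(\<Sum>N\<in>A ` UNIV. \<Sum>i'\<in>{i'\<in>UNIV. A i' = N}. \<pi> i' * w $ i' $ e * z $ i' $ e) = 0"
      by (intro sum.neutral) blast
    then show ?thesis
      using sum.image_gen[where S = UNIV and g = A and h = "\<lambda>i. \<pi> i * w $ i $ e * z $ i $ e", OF finite]
      by simp
  qed
  then have "(\<Sum>e\<in>UNIV. \<Sum>i\<in>UNIV. \<pi> i * w $ i $ e * z $ i $ e) = 0" by simp
  then show ?thesis
    by (subst (asm) sum.swap) (simp add: inner_vec_def)
qed

lemma nonant_star_weighted_orthogonal_comp:
  fixes G :: "('n, 's::finite) scenario_tree" and \<tau> :: "'e::finite \<Rightarrow> nat"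
  assumes "is_scenario_tree T G" and "range \<tau> = {1..<T}" and "w \<in> nonant_star G \<tau> \<pi>"
  shows "(\<chi> i. \<pi> i *\<^sub>R w $ i) \<in> (nonant G \<tau>)\<^sup>\<bottom>"
  using nonant_orthogonal_nonant_star[OF assms(1,2) _ assms(3)]
  by (auto simp: orthogonal_comp_def orthogonal_def inner_commute)

lemma nonantD:
  assumes "z \<in> nonant G \<tau>" and "N \<in> nonleaf_nodes G" and "i \<in> leaf_descendants G N"
    and "i' \<in> leaf_descendants G N" and "\<tau> e = stage G N"
  shows "z $ i $ e = z $ i' $ e"
  using assms unfolding nonant_def by blast

lemma subspace_nonant: "subspace (nonant G \<tau>)"
  unfolding subspace_def
proof (intro conjI ballI allI)
  show "0 \<in> nonant G \<tau>" by (simp add: nonant_def)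
  fix x y assume xy: "x \<in> nonant G \<tau>" "y \<in> nonant G \<tau>"
  show "x + y \<in> nonant G \<tau>"
    unfolding nonant_def
  proof (intro CollectI ballI allI impI)
    fix N i i' e
    assume *: "N \<in> nonleaf_nodes G" "i \<in> leaf_descendants G N" "i' \<in> leaf_descendants G N"
      "\<tau> e = stage G N"
    show "(x + y) $ i $ e = (x + y) $ i' $ e"
      using nonantD[OF xy(1) *] nonantD[OF xy(2) *] by simp
  qed
next
  fix c x assume x: "x \<in> nonant G \<tau>"
  show "c *\<^sub>R x \<in> nonant G \<tau>"
    unfolding nonant_def
  proof (intro CollectI ballI allI impI)
    fix N i i' e
    assume *: "N \<in> nonleaf_nodes G" "i \<in> leaf_descendants G N" "i' \<in> leaf_descendants G N"
      "\<tau> e = stage G N"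
    show "(c *\<^sub>R x) $ i $ e = (c *\<^sub>R x) $ i' $ e"
      using nonantD[OF x *] by simp
  qed
qed

lemma closed_nonant_star: "closed (nonant_star G \<tau> \<pi>)"
proof -
  have "nonant_star G \<tau> \<pi> = (\<Inter>N\<in>nonleaf_nodes G. \<Inter>e\<in>{e. \<tau> e = stage G N}.
      {w. (\<Sum>i \<in> leaf_descendants G N. \<pi> i * w $ i $ e) = 0})"
    by (auto simp: nonant_star_def)
  also have "closed \<dots>"
    by (intro closed_INT ballI closed_Collect_eq continuous_intros)
  finally show ?thesis .
qed

section \<open>Subgradients under a linear map\<close>

text \<open>With \<open>c = x + b\<close>, the minimizer \<open>u\<close> of \<open>F\<close> plus
  \<open>s / 2\<close> times the squared distance to \<open>c\<close> has the subgradient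
  \<open>s *\<^sub>R (c - u)\<close>. As this is orthogonal to \<open>b\<close>, the subgradient
  inequality tested at \<open>x\<close> gives
  \<open>F u + s * (norm (u - c))\<^sup>2 \<le> F x\<close>; as \<open>s\<close> grows,
  \<open>u\<close> tends to \<open>c\<close>.\<close>

lemma subdifferential_orthogonal_invariant:
  fixes F :: "'a::euclidean_space \<Rightarrow> ereal"
  assumes F: "closed_proper_convex F" and g0: "g0 \<in> subdifferential F x0"
    and orth: "\<And>y g. g \<in> subdifferential F y \<Longrightarrow> g \<bullet> b = 0"
  shows "F (x + b) \<le> F x"
proof (cases "F x")
  case (real m)
  note nm = closed_proper_convex_not_minfty[OF F]
  define c where "c = x + b"
  obtain a0 where a0: "F x0 = ereal a0"
    using closed_proper_convex_subdifferential_finite[OF F g0] .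
  define \<alpha> where "\<alpha> = a0 + g0 \<bullet> (c - x0)"
  have minor: "ereal (\<alpha> + g0 \<bullet> (u - c)) \<le> F u" for u
    using subdifferentialD[OF g0 a0, of u] nm[of u]
    by (cases "F u") (auto simp: \<alpha>_def inner_simps)
  define K where "K = m - \<alpha> + (norm g0)\<^sup>2 / 2"
  have "\<exists>u. F u \<le> ereal m \<and> (norm (u - c))\<^sup>2 \<le> 2 * K * (1 / real (Suc n))" for n
  proof -
    define s where "s = real (Suc n)"
    have s: "1 \<le> s" by (simp add: s_def)
    let ?h = "\<lambda>u. s / 2 * (norm (u - c))\<^sup>2"
    obtain u where min: "\<And>y. F u + ereal (?h u) \<le> F y + ereal (?h y)"
      by (rule minimizer_add_quadratic_exists[OF F minor, of ?h "s / 2"])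
        (use s in \<open>auto intro!: continuous_intros\<close>)
    have "- (s *\<^sub>R (u - c)) \<in> subdifferential F u"
    proof (rule minimizer_add_subdifferential[OF F min], rule exI, rule ballI)
      fix d and t :: real
      have "?h (u + t *\<^sub>R d) = s / 2 * (norm ((u - c) + t *\<^sub>R d))\<^sup>2" by (simp add: algebra_simps)
      also have "\<dots> = ?h u + t * ((s *\<^sub>R (u - c)) \<bullet> d) + t * t * (s / 2 * (norm d)\<^sup>2)"
        unfolding norm_add_scaleR_squared by (simp add: distrib_left)
      finally show "?h (u + t *\<^sub>R d) \<le> ?h u + t * ((s *\<^sub>R (u - c)) \<bullet> d) + t * t * (s / 2 * (norm d)\<^sup>2)"
        by simp
    qed
    then have g: "s *\<^sub>R (c - u) \<in> subdifferential F u"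
      by (simp flip: scaleR_minus_right)
    obtain a where a: "F u = ereal a"
      using closed_proper_convex_subdifferential_finite[OF F g] .
    let ?t = "norm (u - c)"
    have "(s *\<^sub>R (c - u)) \<bullet> (x - u) = (s *\<^sub>R (c - u)) \<bullet> (c - u)"
      using orth[OF g] by (simp add: c_def inner_simps)
    also have "\<dots> = s * ?t\<^sup>2" by (simp add: power2_norm_eq_inner inner_diff inner_commute)
    finally have m: "a + s * ?t\<^sup>2 \<le> m" using subdifferentialD[OF g a real] by linarith
    have "\<alpha> + g0 \<bullet> (u - c) \<le> a" using minor[of u] a by simp
    moreover have "- (norm g0 * ?t) \<le> g0 \<bullet> (u - c)"
      using Cauchy_Schwarz_ineq2[of g0 "u - c"] by linarith
    moreover have "norm g0 * ?t \<le> (norm g0)\<^sup>2 / 2 + ?t\<^sup>2 / 2"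
      using sum_squares_bound[of "norm g0" ?t] by simp
    ultimately have "s * ?t\<^sup>2 - ?t\<^sup>2 / 2 \<le> K" using m unfolding K_def by linarith
    moreover have "s / 2 * ?t\<^sup>2 \<le> s * ?t\<^sup>2 - ?t\<^sup>2 / 2"
      using mult_right_mono[OF s, of "?t\<^sup>2 / 2"] by simp
    ultimately have "s / 2 * ?t\<^sup>2 \<le> K" by linarith
    then have "?t\<^sup>2 \<le> 2 * K * (1 / s)" using s by (simp add: field_simps)
    moreover have "0 \<le> ?t\<^sup>2" by simp
    then have "a \<le> m" using m mult_nonneg_nonneg[of s "?t\<^sup>2"] s by linarith
    ultimately show ?thesis using a by (intro exI[of _ u]) (simp add: s_def)
  qed
  then obtain u where u: "\<And>n. F (u n) \<le> ereal m" "\<And>n. (norm (u n - c))\<^sup>2 \<le> 2 * K * (1 / real (Suc n))"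
    by metis
  have "(\<lambda>n. 2 * K * (1 / real (Suc n))) \<longlonglongrightarrow> 2 * K * 0"
    by (intro tendsto_intros LIMSEQ_Suc[OF lim_1_over_n])
  then have lim: "(\<lambda>n. 2 * K * (1 / real (Suc n))) \<longlonglongrightarrow> 0" by (simp only: mult_zero_right)
  have "(\<lambda>n. (norm (u n - c))\<^sup>2) \<longlonglongrightarrow> 0"
    by (rule tendsto_sandwich[OF _ _ tendsto_const lim]) (use u(2) in \<open>auto intro!: always_eventually\<close>)
  from tendsto_real_sqrt[OF this] have "u \<longlonglongrightarrow> c" by (simp add: tendsto_norm_zero_iff LIM_zero_iff)
  from closed_proper_convex_limit[OF F this tendsto_const u(1)] show ?thesis
    using real by (simp add: c_def)
qed (use F in \<open>auto simp: closed_proper_convex_def\<close>)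

lemma bounded_componentwise_inner:
  fixes x :: "nat \<Rightarrow> 'a::euclidean_space"
  assumes "\<And>h. \<exists>B. \<forall>k. \<bar>h \<bullet> x k\<bar> \<le> B"
  shows "bounded (range x)"
proof -
  obtain B where "\<And>h k. \<bar>h \<bullet> x k\<bar> \<le> B h" using assms by metis
  then have "norm (x k) \<le> (\<Sum>h\<in>Basis. B h)" for k
    using norm_le_l1[of "x k"] sum_mono[of Basis "\<lambda>h. \<bar>x k \<bullet> h\<bar>" B]
    by (simp add: inner_commute)
  then show ?thesis by (auto intro: boundedI)
qed

lemma convergent_abs_le:
  fixes a :: "nat \<Rightarrow> real"
  assumes "a \<longlonglongrightarrow> l"
  shows "\<exists>B. \<forall>k. \<bar>a k\<bar> \<le> B"
  using convergent_imp_Bseq[OF convergentI[OF assms]] by (auto simp: Bseq_def)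

text \<open>The points \<open>x k\<close> may run off to infinity, but only along directions in which \<open>F\<close> is constant
  and which \<open>A\<close> annihilates; projecting those directions away makes the sequence bounded.\<close>

lemma subdifferential_closed_under_map:
  fixes F :: "'a::euclidean_space \<Rightarrow> ereal" and A :: "'a \<Rightarrow> 'b::euclidean_space"
  assumes F: "closed_proper_convex F" and A: "linear A"
    and R: "R = (\<Union>x. subdifferential F x)" and p: "adjoint A p \<in> R" and \<delta>: "0 < \<delta>"
    and ri: "\<And>e. e \<in> span ((\<lambda>y. y - adjoint A p) ` R) \<Longrightarrow> norm e < \<delta> \<Longrightarrow> adjoint A p + e \<in> R"
    and g: "\<And>k. adjoint A (q k) \<in> subdifferential F (x k)"
    and q: "q \<longlonglongrightarrow> q'" and z: "(\<lambda>k. A (x k)) \<longlonglongrightarrow> z"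
  shows "\<exists>y. A y = z \<and> adjoint A q' \<in> subdifferential F y"
proof -
  let ?A = "adjoint A"
  \<comment> \<open>\<open>E\<close> is the direction space of the affine hull of \<open>R\<close>,
    and \<open>H\<close> adds the range of the adjoint; the orthogonal complement of
    \<open>H\<close> consists of the directions to be removed.\<close>
  define E where "E = span ((\<lambda>y. y - ?A p) ` R)"
  define H where "H = span (range ?A \<union> E)"
  have adj: "u \<bullet> ?A v = A u \<bullet> v" "?A v \<bullet> u = v \<bullet> A u" for u v
    using adjoint_works[OF A] by (auto simp: inner_commute)
  have lin: "linear ?A" by (rule adjoint_linear[OF A])
  have contA: "(\<lambda>k. A (a k)) \<longlonglongrightarrow> A l" if "a \<longlonglongrightarrow> l" for a l
    using bounded_linear.tendsto[OF _ that] A linear_conv_bounded_linear by blast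
  have contA': "(\<lambda>k. ?A (a k)) \<longlonglongrightarrow> ?A l" if "a \<longlonglongrightarrow> l" for a l
    using bounded_linear.tendsto[OF _ that] lin linear_conv_bounded_linear by blast
  \<comment> \<open>Monotonicity between the subgradients at \<open>x k\<close> and at a point with
    subgradient \<open>?A p + e\<close> bounds \<open>e \<bullet> x k\<close> by a convergent
    sequence; the relative interior supplies such a point for small \<open>e\<close>.\<close>
  have upper: "\<exists>B. \<forall>k. e \<bullet> x k \<le> B" if e: "e \<in> E" "norm e < \<delta>" for e
  proof -
    obtain y where y: "?A p + e \<in> subdifferential F y"
      using ri[OF e[unfolded E_def]] R by blast
    have "e \<bullet> x k \<le> (q k - p) \<bullet> A (x k) - (?A (q k) - ?A p - e) \<bullet> y" for k
      using subdifferential_monotone[OF F g[of k] y] by (simp add: inner_simps adj)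
    moreover have "(\<lambda>k. (q k - p) \<bullet> A (x k) - (?A (q k) - ?A p - e) \<bullet> y)
        \<longlonglongrightarrow> (q' - p) \<bullet> z - (?A q' - ?A p - e) \<bullet> y"
      by (intro tendsto_intros contA' q z)
    then obtain B where "\<And>k. \<bar>(q k - p) \<bullet> A (x k) - (?A (q k) - ?A p - e) \<bullet> y\<bar> \<le> B"
      using convergent_abs_le by blast
    ultimately show ?thesis by (meson abs_le_D1 order_trans)
  qed
  define Bd where "Bd = {h. \<exists>B. \<forall>k. \<bar>h \<bullet> x k\<bar> \<le> B}"
  have subBd: "subspace Bd"
    unfolding subspace_def
  proof (intro conjI ballI allI)
    show "0 \<in> Bd" by (auto simp: Bd_def)
    fix h h' c assume "h \<in> Bd" "h' \<in> Bd"
    then obtain B B' where B: "\<And>k. \<bar>h \<bullet> x k\<bar> \<le> B" "\<And>k. \<bar>h' \<bullet> x k\<bar> \<le> B'"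
      by (auto simp: Bd_def)
    have "\<bar>(h + h') \<bullet> x k\<bar> \<le> B + B'" for k
      using B(1)[of k] B(2)[of k] by (simp add: inner_add_left)
    then show "h + h' \<in> Bd" by (auto simp: Bd_def)
  next
    fix c :: real and h assume "h \<in> Bd"
    then obtain B where B: "\<And>k. \<bar>h \<bullet> x k\<bar> \<le> B" by (auto simp: Bd_def)
    have "\<bar>(c *\<^sub>R h) \<bullet> x k\<bar> \<le> \<bar>c\<bar> * B" for k
      using mult_left_mono[OF B[of k], of "\<bar>c\<bar>"] by (simp add: abs_mult)
    then show "c *\<^sub>R h \<in> Bd" by (auto simp: Bd_def)
  qed
  have "E \<subseteq> Bd"
  proof
    fix e assume e: "e \<in> E"
    \<comment> \<open>Scaling into the \<open>\<delta>\<close>-ball makes \<open>upper\<close>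
      applicable to \<open>s *\<^sub>R e\<close> and to its negative, which gives a two-sided
      bound.\<close>
    define s where "s = \<delta> / (2 * (norm e + 1))"
    have s: "0 < s" using \<delta> by (simp add: s_def add_nonneg_pos)
    have "norm (s *\<^sub>R e) < \<delta>"
    proof -
      have "norm (s *\<^sub>R e) = \<delta> * (norm e / (2 * (norm e + 1)))"
        using \<delta> s by (simp add: s_def)
      also have "norm e / (2 * (norm e + 1)) < 1" by (simp add: divide_less_eq add_nonneg_pos)
      finally show ?thesis using \<delta> by simp
    qed
    moreover have "s *\<^sub>R e \<in> E" "- (s *\<^sub>R e) \<in> E"
      using e unfolding E_def by (auto intro: span_scale span_neg)
    ultimately obtain B B' where B: "\<And>k. (s *\<^sub>R e) \<bullet> x k \<le> B" "\<And>k. (- (s *\<^sub>R e)) \<bullet> x k \<le> B'"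
      using upper by (metis norm_minus_cancel)
    have "\<bar>(s *\<^sub>R e) \<bullet> x k\<bar> \<le> max B B'" for k using B(1)[of k] B(2)[of k] by auto
    then have "s *\<^sub>R e \<in> Bd" by (auto simp: Bd_def)
    then have "(1 / s) *\<^sub>R (s *\<^sub>R e) \<in> Bd" by (rule subspace_scale[OF subBd])
    then show "e \<in> Bd" using s by simp
  qed
  moreover have "?A v \<in> Bd" for v
  proof -
    have "(\<lambda>k. ?A v \<bullet> x k) \<longlonglongrightarrow> v \<bullet> z" unfolding adj by (intro tendsto_intros z)
    from convergent_abs_le[OF this] show ?thesis by (simp add: Bd_def)
  qed
  ultimately have HBd: "H \<subseteq> Bd"
    unfolding H_def by (intro span_minimal subBd) auto
  have "\<exists>u b. u \<in> H \<and> (\<forall>h\<in>H. b \<bullet> h = 0) \<and> x k = u + b" for k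
    using orthogonal_subspace_decomp_exists[of "range ?A \<union> E" "x k"]
    unfolding H_def orthogonal_def by metis
  then obtain u b where u: "\<And>k. u k \<in> H" and b: "\<And>k h. h \<in> H \<Longrightarrow> b k \<bullet> h = 0"
      and x: "\<And>k. x k = u k + b k"
    by metis
  \<comment> \<open>Only the part \<open>h1\<close> of \<open>h\<close> in \<open>H\<close> sees
    \<open>u k\<close>, and it does not see \<open>b k\<close>, so the bound for \<open>x k\<close>
    carries over.\<close>
  have "\<exists>B. \<forall>k. \<bar>h \<bullet> u k\<bar> \<le> B" for h
  proof -
    obtain h1 h2 where h: "h1 \<in> H" "\<And>w. w \<in> H \<Longrightarrow> h2 \<bullet> w = 0" "h = h1 + h2"
      using orthogonal_subspace_decomp_exists[of "range ?A \<union> E" h]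
      unfolding H_def orthogonal_def by metis
    obtain B where "\<And>k. \<bar>h1 \<bullet> x k\<bar> \<le> B" using HBd h(1) by (auto simp: Bd_def)
    moreover have "h \<bullet> u k = h1 \<bullet> x k" for k
      using h(2)[OF u[of k]] b[OF h(1), of k] by (simp add: h(3) x inner_simps inner_commute)
    ultimately show ?thesis by auto
  qed
  then have "bounded (range u)" by (rule bounded_componentwise_inner)
  then obtain l r where r: "strict_mono r" and l: "(u \<circ> r) \<longlonglongrightarrow> l"
    using bounded_imp_convergent_subsequence by blast
  have Ab: "A (b k) = 0" for k
  proof -
    have "?A (A (b k)) \<in> H" unfolding H_def by (intro span_base) auto
    then have "A (b k) \<bullet> A (b k) = 0" using b adj by metis
    then show ?thesis by simp
  qed
  have orth: "g \<bullet> (- b k) = 0" if "g \<in> subdifferential F y" for g y k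
  proof -
    have "g - ?A p \<in> E" unfolding E_def R using that by (intro span_base) auto
    then have "b k \<bullet> (g - ?A p) = 0" using b unfolding H_def by (auto intro: span_base)
    then show ?thesis using Ab[of k] by (simp add: inner_simps adj inner_commute[of g])
  qed
  \<comment> \<open>Passing from \<open>x k\<close> to \<open>u k\<close> does not raise
    \<open>F\<close>, and it leaves the supporting affine function unchanged because
    \<open>?A (q k)\<close> is orthogonal to \<open>b k\<close>.\<close>
  have gu: "?A (q k) \<in> subdifferential F (u k)" for k
  proof -
    obtain a where a: "F (x k) = ereal a"
      using closed_proper_convex_subdifferential_finite[OF F g[of k]] .
    note nm = closed_proper_convex_not_minfty[OF F]
    have "F (x k + - b k) \<le> F (x k)"
      by (rule subdifferential_orthogonal_invariant[OF F g[of 0] orth])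
    then obtain a' where a': "F (u k) = ereal a'" "a' \<le> a"
      using nm[of "u k"] a by (cases "F (u k)") (auto simp: x)
    have gb: "?A (q k) \<bullet> b k = 0" using orth[OF g[of k]] by simp
    show ?thesis
    proof (rule subdifferentialI[where F = F, OF a'(1) nm])
      fix y c assume "F y = ereal c"
      from subdifferentialD[OF g[of k] a this] a'(2) gb
      show "a' + ?A (q k) \<bullet> (y - u k) \<le> c" by (simp add: x inner_simps)
    qed
  qed
  have "?A q' \<in> subdifferential F l"
    by (rule subdifferential_closed_graph[OF F l, of "\<lambda>k. ?A (q (r k))"])
      (use gu contA'[OF LIMSEQ_subseq_LIMSEQ[OF q r]] in \<open>auto simp: o_def\<close>)
  moreover have "A (u k) = A (x k)" for k
    using Ab by (simp add: x linear_add[OF A])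
  then have "A l = z"
    using LIMSEQ_unique[OF contA[OF l]] LIMSEQ_subseq_LIMSEQ[OF z r] by (simp add: o_def)
  ultimately show ?thesis by blast
qed

section \<open>Subproblems and dual terms\<close>

lemma adjoint_fst: "adjoint (fst :: 'a::euclidean_space \<times> 'b::euclidean_space \<Rightarrow> 'a) p = (p, 0)"
proof -
  have "adjoint (fst :: 'a \<times> 'b \<Rightarrow> 'a) = (\<lambda>p. (p, 0))"
    by (rule adjoint_unique) (auto simp: inner_prod_def)
  then show ?thesis by simp
qed

lemma adjoint_M:
  "adjoint (M :: ((real^'e) \<times> (real^'d))^'s::finite \<Rightarrow> real^'e^'s) p = (\<chi> i. (p $ i, 0))"
proof -
  have "adjoint (M :: ((real^'e) \<times> (real^'d))^'s \<Rightarrow> real^'e^'s) = (\<lambda>p. \<chi> i. (p $ i, 0))"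
    by (rule adjoint_unique) (auto simp: M_def inner_vec_def[where 'b = 's] inner_prod_def)
  then show ?thesis by simp
qed

lemma dual_term_eq: "dual_term \<pi> f i p = (SUP x. ereal (- (p \<bullet> fst x)) - ereal (\<pi> i) * f i x)"
  by (simp add: dual_term_def conjugate_def adjoint_fst inner_prod_def)

lemma dual_term_le_iff:
  assumes pos: "0 < \<pi> i" and F: "closed_proper_convex (f i)"
  shows "dual_term \<pi> f i p \<le> ereal r \<longleftrightarrow> (\<forall>x b. f i x = ereal b \<longrightarrow> - (p \<bullet> fst x) - \<pi> i * b \<le> r)"
proof -
  have "ereal (- (p \<bullet> fst x)) - ereal (\<pi> i) * f i x \<le> ereal r
      \<longleftrightarrow> (\<forall>b. f i x = ereal b \<longrightarrow> - (p \<bullet> fst x) - \<pi> i * b \<le> r)" for x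
    using pos closed_proper_convex_not_minfty[OF F, of x] by (cases "f i x") auto
  then show ?thesis by (auto simp: dual_term_eq SUP_le_iff)
qed

lemma dual_term_ge:
  assumes "f i x = ereal b"
  shows "ereal (- (p \<bullet> fst x) - \<pi> i * b) \<le> dual_term \<pi> f i p"
  unfolding dual_term_eq by (rule SUP_upper2[of x]) (use assms in auto)

text \<open>The epigraph is an intersection of closed half-spaces, one per finite value of
  \<open>f i\<close>. \<open>fin\<close> excludes the case that the conjugate, composed with the
  adjoint, is infinite everywhere.\<close>

lemma dual_term_closed_proper_convex:
  assumes pos: "0 < \<pi> i" and F: "closed_proper_convex (f i)" and fin: "dual_term \<pi> f i q \<noteq> \<infinity>"
  shows "closed_proper_convex (dual_term \<pi> f i)"
proof -
  let ?H = "\<lambda>x b. {y. (- fst x, - 1) \<bullet> y \<le> \<pi> i * b}"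
  have epi: "{(p, r). dual_term \<pi> f i p \<le> ereal r} = (\<Inter>(x, b)\<in>{(x, b). f i x = ereal b}. ?H x b)"
  proof -
    have half: "(- u, - 1) \<bullet> (p, r) \<le> \<pi> i * b \<longleftrightarrow> - (p \<bullet> u) - \<pi> i * b \<le> r" for u p r b
      by (simp add: inner_prod_def inner_commute) linarith
    show ?thesis
      by (auto simp: dual_term_le_iff[where f = f and i = i and \<pi> = \<pi>, OF pos F] half simp del: inner_Pair)
  qed
  obtain x b where "f i x = ereal b" using closed_proper_convex_finite_point[OF F] .
  then have "dual_term \<pi> f i p \<noteq> -\<infinity>" for p
    using dual_term_ge[of f i x b p \<pi>] by auto
  then show ?thesis
    unfolding closed_proper_convex_def epi
    using fin by (auto intro!: closed_INT convex_INT closed_halfspace_le convex_halfspace_le)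
qed

text \<open>Equality in the Fenchel-Young inequality: the supremum defining the dual term at
  \<open>\<pi> i *\<^sub>R q\<close> is attained at \<open>x\<close>, and the affine function
  contributed by \<open>x\<close> touches the dual term there with slope
  \<open>- fst x\<close>.\<close>

lemma subdifferential_dual_term:
  assumes pos: "0 < \<pi> i" and F: "closed_proper_convex (f i)"
    and g: "(- q, 0) \<in> subdifferential (f i) x"
  shows "- fst x \<in> subdifferential (dual_term \<pi> f i) (\<pi> i *\<^sub>R q)"
    and "dual_term \<pi> f i (\<pi> i *\<^sub>R q) \<noteq> \<infinity>"
proof -
  obtain b where b: "f i x = ereal b"
    using closed_proper_convex_subdifferential_finite[OF F g] .
  let ?a = "- ((\<pi> i *\<^sub>R q) \<bullet> fst x) - \<pi> i * b"
  have "- ((\<pi> i *\<^sub>R q) \<bullet> fst y) - \<pi> i * c \<le> ?a" if "f i y = ereal c" for y c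
  proof -
    have "b + (- q, 0) \<bullet> (y - x) \<le> c" by (rule subdifferentialD[OF g b that])
    then have "b - q \<bullet> (fst y - fst x) \<le> c" by (simp add: inner_prod_def)
    then have "\<pi> i * (b - q \<bullet> (fst y - fst x)) \<le> \<pi> i * c" using pos by simp
    then show ?thesis by (simp add: inner_diff algebra_simps)
  qed
  then have "dual_term \<pi> f i (\<pi> i *\<^sub>R q) \<le> ereal ?a"
    by (simp add: dual_term_le_iff[where f = f and i = i and \<pi> = \<pi>, OF pos F])
  then have eq: "dual_term \<pi> f i (\<pi> i *\<^sub>R q) = ereal ?a"
    using dual_term_ge[where f = f and i = i, OF b, of "\<pi> i *\<^sub>R q" \<pi>] by (intro antisym) auto
  then show "dual_term \<pi> f i (\<pi> i *\<^sub>R q) \<noteq> \<infinity>" by simp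
  show "- fst x \<in> subdifferential (dual_term \<pi> f i) (\<pi> i *\<^sub>R q)"
  proof (rule subdifferentialI[where F = "dual_term \<pi> f i", OF eq])
    show "dual_term \<pi> f i y \<noteq> -\<infinity>" for y using dual_term_ge[where f = f and i = i, OF b, of y \<pi>] by auto
    show "?a + - fst x \<bullet> (y - \<pi> i *\<^sub>R q) \<le> c" if "dual_term \<pi> f i y = ereal c" for y c
      using dual_term_ge[where f = f and i = i, OF b, of y \<pi>] that by (simp add: inner_diff inner_commute)
  qed
qed

section \<open>Optimality and error bounds for the scenario subproblems\<close>

definition penalty :: "('e::finite \<Rightarrow> real) \<Rightarrow> real^'e \<Rightarrow> real^'e \<Rightarrow> real^'e \<Rightarrow> real" where
  "penalty \<rho> w z u = (\<Sum>e\<in>UNIV. w $ e * u $ e + \<rho> e / 2 * (u $ e - z $ e)\<^sup>2)"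

lemma penalty_add:
  "penalty \<rho> w z (u + d) = penalty \<rho> w z u + (\<chi> e. w $ e + \<rho> e * (u $ e - z $ e)) \<bullet> d
    + (\<Sum>e\<in>UNIV. \<rho> e / 2 * (d $ e)\<^sup>2)"
  unfolding penalty_def inner_vec_def sum.distrib[symmetric]
  by (rule sum.cong) (simp_all add: power2_eq_square field_simps)

lemma penalty_add_scaleR:
  "penalty \<rho> w z (u + t *\<^sub>R d) = penalty \<rho> w z u + t * ((\<chi> e. w $ e + \<rho> e * (u $ e - z $ e)) \<bullet> d)
    + t * t * (\<Sum>e\<in>UNIV. \<rho> e / 2 * (d $ e)\<^sup>2)"
  by (simp add: penalty_add sum_distrib_left power2_eq_square mult_ac)

text \<open>Stationarity; the last-stage component of the subgradient is 0 because the penalty sees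
  only the part retained by \<open>Mbar\<close>.\<close>

lemma subproblem_minimizer_subdifferential:
  assumes F: "closed_proper_convex F" and min: "is_minimizer UNIV (subproblem_obj \<rho> F w z) x"
  shows "(- (\<chi> e. w $ e + \<rho> e * (fst x $ e - z $ e)), 0) \<in> subdifferential F x"
proof -
  let ?q = "\<chi> e. w $ e + \<rho> e * (fst x $ e - z $ e)"
  have "- (?q, 0) \<in> subdifferential F x"
  proof (rule minimizer_add_subdifferential[OF F, of _ "\<lambda>x. penalty \<rho> w z (fst x)"])
    show "F x + ereal (penalty \<rho> w z (fst x)) \<le> F y + ereal (penalty \<rho> w z (fst y))" for y
    proof -
      have "subproblem_obj \<rho> F w z x \<le> subproblem_obj \<rho> F w z y"
        using min unfolding is_minimizer_def by blast
      then show ?thesis unfolding subproblem_obj_def penalty_def .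
    qed
    fix d
    show "\<exists>C. \<forall>t\<in>{0<..1}. penalty \<rho> w z (fst (x + t *\<^sub>R d))
        \<le> penalty \<rho> w z (fst x) + t * ((?q, 0) \<bullet> d) + t * t * C"
      by (intro exI[of _ "\<Sum>e\<in>UNIV. \<rho> e / 2 * (fst d $ e)\<^sup>2"] ballI)
        (simp add: penalty_add_scaleR inner_prod_def)
  qed
  then show ?thesis by simp
qed

lemma approx_subproblem_le:
  assumes "x \<in> approx_arg_min \<sigma> UNIV (subproblem_obj \<rho> F w z)"
    and "F x \<noteq> -\<infinity>" and "F y = ereal b"
  shows "F x \<le> ereal (b + penalty \<rho> w z (fst y) + \<sigma> - penalty \<rho> w z (fst x))"
proof -
  have "F x + ereal (penalty \<rho> w z (fst x))
      \<le> (INF u. F u + ereal (penalty \<rho> w z (fst u))) + ereal \<sigma>"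
    using assms(1) by (simp add: approx_arg_min_def subproblem_obj_def penalty_def)
  also have "\<dots> \<le> F y + ereal (penalty \<rho> w z (fst y)) + ereal \<sigma>"
    by (intro add_right_mono INF_lower) simp
  finally show ?thesis using assms(2,3) by (cases "F x") auto
qed

text \<open>The linear part of the penalty expansion at the exact minimizer cancels against the
  subgradient inequality there; the quadratic remainder is then at most the tolerance
  \<open>\<sigma>\<close>.\<close>

lemma approx_subproblem_error:
  assumes F: "closed_proper_convex F" and x: "x \<in> approx_arg_min \<sigma> UNIV (subproblem_obj \<rho> F w z)"
    and min: "is_minimizer UNIV (subproblem_obj \<rho> F w z) y"
  shows "(\<Sum>e\<in>UNIV. \<rho> e * (fst x $ e - fst y $ e)\<^sup>2) \<le> 2 * \<sigma>"
proof -
  let ?q = "\<chi> e. w $ e + \<rho> e * (fst y $ e - z $ e)"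
  have g: "(- ?q, 0) \<in> subdifferential F y"
    by (rule subproblem_minimizer_subdifferential[OF F min])
  obtain b where b: "F y = ereal b" using closed_proper_convex_subdifferential_finite[OF F g] .
  note nm = closed_proper_convex_not_minfty[OF F, of x]
  note le = approx_subproblem_le[OF x nm b]
  obtain a where a: "F x = ereal a" using le nm by (cases "F x") auto
  have "b + (- ?q, 0) \<bullet> (x - y) \<le> a" by (rule subdifferentialD[OF g b a])
  moreover have "penalty \<rho> w z (fst x) = penalty \<rho> w z (fst y) + ?q \<bullet> (fst x - fst y)
      + (\<Sum>e\<in>UNIV. \<rho> e / 2 * (fst x $ e - fst y $ e)\<^sup>2)"
    using penalty_add[of \<rho> w z "fst y" "fst x - fst y"] by simp
  ultimately have "(\<Sum>e\<in>UNIV. \<rho> e / 2 * (fst x $ e - fst y $ e)\<^sup>2) \<le> \<sigma>"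
    using le a by (simp add: inner_prod_def)
  then have "2 * (\<Sum>e\<in>UNIV. \<rho> e / 2 * (fst x $ e - fst y $ e)\<^sup>2) \<le> 2 * \<sigma>" by simp
  then show ?thesis by (simp add: sum_distrib_left)
qed

text \<open>A proximal step in a diagonal metric, written as a penalty with multiplier 0. Applied to
  the dual terms, it makes the resolvent total.\<close>

lemma proximal_point_exists:
  fixes F :: "real^'e::finite \<Rightarrow> ereal"
  assumes F: "closed_proper_convex F" and minor: "\<And>x. ereal (\<alpha> + g \<bullet> x) \<le> F x"
    and \<rho>: "\<And>e. 0 < \<rho> e"
  obtains p where "- (\<chi> e. \<rho> e * (p $ e - z $ e)) \<in> subdifferential F p"
proof -
  let ?h = "penalty \<rho> 0 z"
  define c where "c = Min (range \<rho>) / 2"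
  have c: "0 < c" using \<rho> by (simp add: c_def)
  have "c * (norm (x - z))\<^sup>2 \<le> ?h x" for x
  proof -
    have "c \<le> \<rho> e / 2" for e by (simp add: c_def)
    then have "(\<Sum>e\<in>UNIV. c * (x $ e - z $ e)\<^sup>2) \<le> (\<Sum>e\<in>UNIV. \<rho> e / 2 * (x $ e - z $ e)\<^sup>2)"
      by (intro sum_mono mult_right_mono) auto
    moreover have "(norm (x - z))\<^sup>2 = (\<Sum>e\<in>UNIV. (x $ e - z $ e)\<^sup>2)"
      unfolding power2_norm_eq_inner inner_vec_def by (simp add: power2_eq_square)
    ultimately show ?thesis by (simp add: penalty_def sum_distrib_left)
  qed
  moreover have "continuous_on UNIV ?h"
    unfolding penalty_def by (intro continuous_intros)
  moreover have "ereal ((\<alpha> + g \<bullet> z) + g \<bullet> (x - z)) \<le> F x" for x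
    using minor[of x] by (simp add: inner_diff)
  ultimately obtain p where p: "\<And>y. F p + ereal (?h p) \<le> F y + ereal (?h y)"
    using minimizer_add_quadratic_exists[OF F _ _ c] by blast
  have "- (\<chi> e. \<rho> e * (p $ e - z $ e)) \<in> subdifferential F p"
  proof (rule minimizer_add_subdifferential[OF F p])
    show "\<exists>C. \<forall>t\<in>{0<..1}. ?h (p + t *\<^sub>R d)
        \<le> ?h p + t * ((\<chi> e. \<rho> e * (p $ e - z $ e)) \<bullet> d) + t * t * C" for d
      by (intro exI[of _ "\<Sum>e\<in>UNIV. \<rho> e / 2 * (d $ e)\<^sup>2"] ballI) (simp add: penalty_add_scaleR)
  qed
  then show thesis by (rule that)
qed

section \<open>Blockwise structure of the primal objective\<close>

lemma primal_obj_real: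
  assumes "\<And>i. f i (x $ i) = ereal (b i)"
  shows "primal_obj \<pi> f x = ereal (\<Sum>i\<in>UNIV. \<pi> i * b i)"
  by (simp add: primal_obj_def assms)

lemma primal_obj_not_minfty:
  assumes "\<And>i. 0 < \<pi> i" and "\<And>i. closed_proper_convex (f i)"
  shows "primal_obj \<pi> f x \<noteq> -\<infinity>"
proof -
  have "ereal (\<pi> i) * f i (x $ i) \<noteq> -\<infinity>" for i
    using assms(1)[of i] closed_proper_convex_not_minfty[OF assms(2)[of i], of "x $ i"]
    by (cases "f i (x $ i)") auto
  then have "(\<Sum>i\<in>I. ereal (\<pi> i) * f i (x $ i)) \<noteq> -\<infinity>" for I
    by (induction I rule: infinite_finite_induct) (auto simp: ereal_plus_eq_MInfty)
  then show ?thesis unfolding primal_obj_def .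
qed

lemma primal_obj_finite:
  assumes "\<And>i. 0 < \<pi> i" and "\<And>i. closed_proper_convex (f i)" and "primal_obj \<pi> f x \<noteq> \<infinity>"
  shows "\<exists>b. \<forall>i. f i (x $ i) = ereal (b i)"
proof -
  have "f i (x $ i) \<noteq> \<infinity>" for i
    using assms(3) assms(1)[of i] unfolding primal_obj_def by (auto simp: sum_Pinfty)
  moreover have "f i (x $ i) \<noteq> -\<infinity>" for i
    by (rule closed_proper_convex_not_minfty[OF assms(2)])
  ultimately have "f i (x $ i) = ereal (real_of_ereal (f i (x $ i)))" for i
    by (metis ereal_real' not_infty_ereal ereal_infinity_cases)
  then show ?thesis by (intro exI[of _ "\<lambda>i. real_of_ereal (f i (x $ i))"] allI)
qed

text \<open>Separability: one direction varies a single block of \<open>x\<close>, the other sums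
  the block inequalities with weights \<open>\<pi> i\<close>; the factor \<open>1 / \<pi> i\<close>
  undoes the weighting.\<close>

lemma subdifferential_primal_obj:
  assumes pos: "\<And>i. 0 < \<pi> i" and F: "\<And>i. closed_proper_convex (f i)"
  shows "y \<in> subdifferential (primal_obj \<pi> f) x
    \<longleftrightarrow> (\<forall>i. (1 / \<pi> i) *\<^sub>R y $ i \<in> subdifferential (f i) (x $ i))"
proof
  assume y: "y \<in> subdifferential (primal_obj \<pi> f) x"
  have "\<forall>i. \<exists>u r. f i u = ereal r" using closed_proper_convex_finite_point[OF F] by metis
  then obtain u r where "\<And>i. f i (u i) = ereal (r i)" by metis
  then have "primal_obj \<pi> f (\<chi> i. u i) \<noteq> \<infinity>" using primal_obj_real[of f "\<chi> i. u i" r \<pi>] by simp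
  then obtain a where a: "primal_obj \<pi> f x = ereal a"
    using subdifferential_finite[OF y primal_obj_not_minfty[OF pos F]] by blast
  then obtain b where b: "\<And>i. f i (x $ i) = ereal (b i)"
    using primal_obj_finite[where f = f and \<pi> = \<pi> and x = x, OF pos F] by auto
  show "\<forall>i. (1 / \<pi> i) *\<^sub>R y $ i \<in> subdifferential (f i) (x $ i)"
  proof
    fix i
    show "(1 / \<pi> i) *\<^sub>R y $ i \<in> subdifferential (f i) (x $ i)"
    proof (rule subdifferentialI[where F = "f i", OF b])
      show "f i v \<noteq> -\<infinity>" for v by (rule closed_proper_convex_not_minfty[OF F])
      fix v c assume c: "f i v = ereal c"
      let ?v = "\<chi> j. if j = i then v else x $ j" and ?c = "\<lambda>j. if j = i then c else b j"
      have v: "primal_obj \<pi> f ?v = ereal (\<Sum>j\<in>UNIV. \<pi> j * ?c j)"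
        by (rule primal_obj_real) (simp add: b c)
      have "(\<Sum>j\<in>UNIV. \<pi> j * b j) + y \<bullet> (?v - x) \<le> (\<Sum>j\<in>UNIV. \<pi> j * ?c j)"
        by (rule subdifferentialD[OF y primal_obj_real[of f x b \<pi>, OF b] v])
      moreover have "y \<bullet> (?v - x) = (\<Sum>j\<in>UNIV. if j = i then y $ i \<bullet> (v - x $ i) else 0)"
        unfolding inner_vec_def by (rule sum.cong) auto
      moreover have "(\<Sum>j\<in>UNIV. \<pi> j * ?c j) - (\<Sum>j\<in>UNIV. \<pi> j * b j)
          = (\<Sum>j\<in>UNIV. if j = i then \<pi> i * (c - b i) else 0)"
        unfolding sum_subtractf[symmetric] by (rule sum.cong) (auto simp: algebra_simps)
      ultimately have "y $ i \<bullet> (v - x $ i) \<le> \<pi> i * (c - b i)" by simp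
      then show "b i + ((1 / \<pi> i) *\<^sub>R y $ i) \<bullet> (v - x $ i) \<le> c"
        using pos[of i] by (simp add: field_simps)
    qed
  qed
next
  assume y: "\<forall>i. (1 / \<pi> i) *\<^sub>R y $ i \<in> subdifferential (f i) (x $ i)"
  have "\<forall>i. \<exists>r. f i (x $ i) = ereal r"
    using closed_proper_convex_subdifferential_finite[OF F] y by metis
  then obtain b where b: "\<And>i. f i (x $ i) = ereal (b i)" by metis
  show "y \<in> subdifferential (primal_obj \<pi> f) x"
  proof (rule subdifferentialI[where F = "primal_obj \<pi> f", OF primal_obj_real[of f x b \<pi>, OF b] primal_obj_not_minfty[OF pos F]])
    fix v c assume v: "primal_obj \<pi> f v = ereal c"
    then obtain r where r: "\<And>i. f i (v $ i) = ereal (r i)"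
      using primal_obj_finite[where f = f and \<pi> = \<pi> and x = v, OF pos F] by auto
    have "\<pi> i * b i + y $ i \<bullet> (v - x) $ i \<le> \<pi> i * r i" for i
    proof -
      have "b i + ((1 / \<pi> i) *\<^sub>R y $ i) \<bullet> (v $ i - x $ i) \<le> r i"
        by (rule subdifferentialD[OF y[rule_format] b r])
      then show ?thesis using pos[of i] by (simp add: field_simps)
    qed
    then have "(\<Sum>i\<in>UNIV. \<pi> i * b i + y $ i \<bullet> (v - x) $ i) \<le> (\<Sum>i\<in>UNIV. \<pi> i * r i)"
      by (intro sum_mono)
    then show "(\<Sum>i\<in>UNIV. \<pi> i * b i) + y \<bullet> (v - x) \<le> c"
      using v primal_obj_real[of f v r \<pi>, OF r] by (simp add: inner_vec_def sum.distrib)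
  qed
qed

section \<open>Progressive hedging as a splitting iteration\<close>

text \<open>The range of the subdifferential of the sum is a product of scaled block ranges.
  Perturbing one block within the span of its range stays in the affine hull, so a relative ball
  survives in that block.\<close>

lemma rel_interior_primal_obj_component:
  fixes f :: "'s::finite \<Rightarrow> (real^'e) \<times> (real^'d) \<Rightarrow> ereal"
  assumes pos: "\<And>i. 0 < \<pi> i" and F: "\<And>i. closed_proper_convex (f i)"
    and p: "adjoint M p \<in> rel_interior (\<Union>x. subdifferential (primal_obj \<pi> f) x)"
    and R: "R = (\<Union>x. subdifferential (f i) x)"
  obtains \<delta> where "0 < \<delta>" and "adjoint fst ((1 / \<pi> i) *\<^sub>R p $ i) \<in> R"
    and "\<And>e. e \<in> span ((\<lambda>y. y - adjoint fst ((1 / \<pi> i) *\<^sub>R p $ i)) ` R) \<Longrightarrow> norm e < \<delta>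
      \<Longrightarrow> adjoint fst ((1 / \<pi> i) *\<^sub>R p $ i) + e \<in> R"
proof -
  let ?S = "\<Union>x. subdifferential (primal_obj \<pi> f) x"
  define Y where "Y = adjoint (M :: ((real^'e) \<times> (real^'d))^'s \<Rightarrow> real^'e^'s) p"
  define P where "P = adjoint (fst :: (real^'e) \<times> (real^'d) \<Rightarrow> real^'e) ((1 / \<pi> i) *\<^sub>R p $ i)"
  have P: "P = (1 / \<pi> i) *\<^sub>R Y $ i" by (simp add: P_def Y_def adjoint_fst adjoint_M)
  have S: "y \<in> ?S \<longleftrightarrow> (\<forall>j. \<exists>x. (1 / \<pi> j) *\<^sub>R y $ j \<in> subdifferential (f j) x)" for y
  proof
    assume "\<forall>j. \<exists>x. (1 / \<pi> j) *\<^sub>R y $ j \<in> subdifferential (f j) x"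
    then obtain x where "\<And>j. (1 / \<pi> j) *\<^sub>R y $ j \<in> subdifferential (f j) (x j)" by metis
    then have "y \<in> subdifferential (primal_obj \<pi> f) (\<chi> j. x j)"
      by (simp add: subdifferential_primal_obj[of \<pi> f, OF pos F])
    then show "y \<in> ?S" by blast
  qed (use subdifferential_primal_obj[of \<pi> f, OF pos F] in blast)
  obtain \<delta> where YS: "Y \<in> ?S" and \<delta>: "0 < \<delta>" "ball Y \<delta> \<inter> affine hull ?S \<subseteq> ?S"
    using p unfolding mem_rel_interior_ball Y_def by blast
  \<comment> \<open>The factor \<open>\<pi> i\<close> cancels the division by \<open>\<pi> i\<close>
    in \<open>S\<close>; it also turns the radius into \<open>\<delta> / \<pi> i\<close>.\<close>
  define emb where "emb e = (\<chi> j. if j = i then \<pi> i *\<^sub>R e else 0)" for e :: "(real^'e) \<times> (real^'d)"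
  have lin: "linear emb"
    by (rule linearI) (auto simp: emb_def vec_eq_iff scaleR_add_right)
  have comp: "(Y + emb e) $ j = (if j = i then Y $ i + \<pi> i *\<^sub>R e else Y $ j)" for e j
    by (simp add: emb_def)
  have hull: "Y + emb e \<in> affine hull ?S" if e: "e \<in> span ((\<lambda>y. y - P) ` R)" for e
  proof -
    have "emb ` (\<lambda>y. y - P) ` R \<subseteq> (\<lambda>y. - Y + y) ` ?S"
    proof
      fix v assume "v \<in> emb ` (\<lambda>y. y - P) ` R"
      then obtain y where y: "y \<in> R" "v = emb (y - P)" by auto
      have "(1 / \<pi> j) *\<^sub>R (Y + v) $ j = (if j = i then y else (1 / \<pi> j) *\<^sub>R Y $ j)" for j
        using pos[of i] unfolding y(2) comp by (simp add: P scaleR_diff_right)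
      then have "Y + v \<in> ?S" using YS y(1) unfolding S R by auto
      then have "- Y + (Y + v) \<in> (\<lambda>y. - Y + y) ` ?S" by (rule imageI)
      then show "v \<in> (\<lambda>y. - Y + y) ` ?S" by simp
    qed
    then have "span (emb ` (\<lambda>y. y - P) ` R) \<subseteq> span ((\<lambda>y. - Y + y) ` ?S)" by (rule span_mono)
    moreover have "emb e \<in> span (emb ` (\<lambda>y. y - P) ` R)"
      using e linear_span_image[OF lin] by blast
    ultimately show ?thesis
      unfolding affine_hull_span_gen[OF hull_inc[OF YS]] by blast
  qed
  have step: "P + e \<in> R" if e: "e \<in> span ((\<lambda>y. y - P) ` R)" and small: "norm e < \<delta> / \<pi> i" for e
  proof -
    have "norm (emb e) = \<pi> i * norm e"
    proof -
      have "emb e = axis i (\<pi> i *\<^sub>R e)" by (simp add: emb_def axis_def vec_eq_iff)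
      then show ?thesis using pos[of i] by (simp add: norm_eq_sqrt_inner inner_axis_axis real_sqrt_mult)
    qed
    also have "\<dots> < \<delta>" using small pos[of i] by (simp add: pos_less_divide_eq mult.commute)
    finally have "Y + emb e \<in> ball Y \<delta>" by (simp add: dist_norm)
    then have "Y + emb e \<in> ?S" using hull[OF e] \<delta>(2) by blast
    then have "(1 / \<pi> i) *\<^sub>R (Y + emb e) $ i \<in> R" unfolding S R by auto
    then show ?thesis unfolding comp using pos[of i] by (simp add: P scaleR_add_right)
  qed
  have "P \<in> R" using YS unfolding S R P by blast
  with that[of "\<delta> / \<pi> i"] step \<delta>(1) pos[of i] show thesis unfolding P_def by simp
qed

text \<open>\<open>dual\<close> adds properness of the dual terms. It follows once each scenario
  subproblem has a minimizer, which yields a subgradient of the form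
  \<open>(- q, 0)\<close>.\<close>

locale stochastic_program =
  fixes T :: nat
    and G :: "('n, 's::finite) scenario_tree"
    and \<tau> :: "'e::finite \<Rightarrow> nat"
    and \<pi> :: "'s \<Rightarrow> real"
    and \<rho> :: "'e \<Rightarrow> real"
    and f :: "'s \<Rightarrow> (real^'e) \<times> (real^'d::finite) \<Rightarrow> ereal"
  assumes tree: "is_scenario_tree T G"
    and stages: "range \<tau> = {1..<T}"
    and pos: "\<And>i. 0 < \<pi> i"
    and rho: "\<And>e. 0 < \<rho> e"
    and f: "\<And>i. closed_proper_convex (f i)"
    and dual: "\<And>i. closed_proper_convex (dual_term \<pi> f i)"
begin

text \<open>These rescalings turn the inner product \<open>\<Sum>i. \<pi> i * \<rho> e * y $ i $ e * z $ i $ e\<close>,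
  in which the algorithm is a relaxed splitting iteration, into the standard one.\<close>

definition up :: "real^'e^'s \<Rightarrow> real^'e^'s" where
  "up y = (\<chi> i e. sqrt (\<pi> i * \<rho> e) * y $ i $ e)"

definition down :: "real^'e^'s \<Rightarrow> real^'e^'s" where
  "down y = (\<chi> i e. y $ i $ e / sqrt (\<pi> i * \<rho> e))"

text \<open>Passage from multipliers \<open>w\<close> to the variable \<open>p\<close> of the dual
  problem.\<close>

definition weight :: "real^'e^'s \<Rightarrow> real^'e^'s" where
  "weight w = (\<chi> i. \<pi> i *\<^sub>R w $ i)"

abbreviation L :: "(real^'e^'s) set" where
  "L \<equiv> up ` nonant G \<tau>"

text \<open>In scaled coordinates \<open>up W\<close> is the dual variable and \<open>down U\<close>
  the primal part; as \<open>down y \<bullet> up z = y \<bullet> z\<close>, monotonicity of the dual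
  subdifferentials is kept.\<close>

definition Q :: "((real^'e^'s) \<times> (real^'e^'s)) set" where
  "Q = {(W, U). \<forall>i. - (down U $ i) \<in> subdifferential (dual_term \<pi> f i) (up W $ i)}"

lemma scale_pos: "0 < sqrt (\<pi> i * \<rho> e)"
  using pos rho by simp

lemma up_down [simp]: "up (down y) = y" and down_up [simp]: "down (up y) = y"
  using pos[THEN less_imp_neq, symmetric] rho[THEN less_imp_neq, symmetric]
  by (simp_all add: up_def down_def vec_eq_iff)

lemma linear_up: "linear up" and linear_down: "linear down"
  by (auto intro!: linearI simp: up_def down_def vec_eq_iff distrib_left add_divide_distrib)

lemma tendsto_up: "(a \<longlongrightarrow> l) A \<Longrightarrow> ((\<lambda>k. up (a k)) \<longlongrightarrow> up l) A"
  and tendsto_down: "(a \<longlongrightarrow> l) A \<Longrightarrow> ((\<lambda>k. down (a k)) \<longlongrightarrow> down l) A"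
  using linear_up linear_down bounded_linear.tendsto linear_conv_bounded_linear by blast+

lemma inner_up: "up y \<bullet> z = y \<bullet> up z"
  by (simp add: up_def inner_vec_def mult_ac)

lemma inner_down_up: "down y \<bullet> up z = y \<bullet> z"
  using inner_up[of "down y" z] by simp

lemma down_orthogonal_comp: "down p \<in> L\<^sup>\<bottom> \<longleftrightarrow> p \<in> (nonant G \<tau>)\<^sup>\<bottom>"
  by (simp add: orthogonal_comp_def orthogonal_def inner_commute[of _ "down p"] inner_down_up
      inner_commute[of _ p])

lemma splitting_dual: "splitting L Q"
proof
  show "subspace L" by (rule linear_subspace_image[OF linear_up subspace_nonant])
next
  fix q u q' u' assume *: "(q, u) \<in> Q" "(q', u') \<in> Q"
  have "0 \<le> (- (down u $ i) - - (down u' $ i)) \<bullet> (up q $ i - up q' $ i)" for i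
    using * by (intro subdifferential_monotone[OF dual]) (auto simp: Q_def)
  then have "0 \<le> (\<Sum>i\<in>UNIV. (- (down u $ i) - - (down u' $ i)) \<bullet> (up q $ i - up q' $ i))"
    by (intro sum_nonneg)
  also have "\<dots> = down (u' - u) \<bullet> up (q - q')"
    unfolding inner_vec_def[of "down (u' - u)"]
    by (simp add: linear_diff[OF linear_up] linear_diff[OF linear_down])
  finally show "(q - q') \<bullet> (u - u') \<le> 0"
    unfolding inner_down_up by (simp add: inner_simps inner_commute)
next
  show "closed Q"
    unfolding closed_sequential_limits
  proof (intro allI impI, elim conjE)
    fix a l assume a: "\<forall>n. a n \<in> Q" and lim: "a \<longlonglongrightarrow> l"
    have "- (down (snd l) $ i) \<in> subdifferential (dual_term \<pi> f i) (up (fst l) $ i)" for i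
    proof (rule subdifferential_closed_graph[OF dual])
      show "(\<lambda>n. up (fst (a n)) $ i) \<longlonglongrightarrow> up (fst l) $ i"
        by (intro tendsto_vec_nth tendsto_up tendsto_fst lim)
      show "(\<lambda>n. - (down (snd (a n)) $ i)) \<longlonglongrightarrow> - (down (snd l) $ i)"
        by (intro tendsto_minus tendsto_vec_nth tendsto_down tendsto_snd lim)
      show "- (down (snd (a n)) $ i) \<in> subdifferential (dual_term \<pi> f i) (up (fst (a n)) $ i)" for n
        using a[rule_format, of n] by (auto simp: Q_def split: prod.splits)
    qed
    then show "l \<in> Q" by (auto simp: Q_def split: prod.splits)
  qed
qed

text \<open>The range condition reduces to one proximal point per scenario, for the dual term with
  weights \<open>1 / (\<pi> i * \<rho> e)\<close> and center \<open>- up a $ i\<close>.\<close>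

lemma minty: "\<exists>u. (u - a, u) \<in> Q"
proof -
  let ?c = "\<lambda>i e. \<pi> i * \<rho> e"
  have "\<exists>p. - (\<chi> e. 1 / ?c i e * (p $ e - (- up a $ i $ e))) \<in> subdifferential (dual_term \<pi> f i) p" for i
  proof -
    obtain x b where b: "f i x = ereal b" using closed_proper_convex_finite_point[OF f] .
    have minor: "ereal (- (\<pi> i * b) + (- fst x) \<bullet> q) \<le> dual_term \<pi> f i q" for q
    proof -
      have "- (\<pi> i * b) + (- fst x) \<bullet> q = - (q \<bullet> fst x) - \<pi> i * b" by (simp add: inner_commute)
      then show ?thesis using dual_term_ge[of f i x b q \<pi>, OF b] by (simp only:)
    qed
    obtain p where "- (\<chi> e. 1 / ?c i e * (p $ e - (- up a $ i) $ e)) \<in> subdifferential (dual_term \<pi> f i) p"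
      by (rule proximal_point_exists[where F = "dual_term \<pi> f i" and \<rho> = "\<lambda>e. 1 / ?c i e"
            and z = "- up a $ i", OF dual minor]) (use pos rho in auto)
    then show ?thesis by auto
  qed
  then obtain p where p: "\<And>i. - (\<chi> e. 1 / ?c i e * (p i $ e - (- up a $ i $ e)))
      \<in> subdifferential (dual_term \<pi> f i) (p i)" by metis
  define u where "u = down (\<chi> i. p i) + a"
  have "down u $ i = (\<chi> e. 1 / ?c i e * (p i $ e - (- up a $ i $ e)))" for i
  proof -
    have "down u $ i $ e = 1 / ?c i e * (p i $ e - (- up a $ i $ e))" for e
    proof -
      have k: "sqrt (?c i e) * sqrt (?c i e) = ?c i e" using pos[of i] rho[of e] by simp
      have "(q / s + r) / s = 1 / (s * s) * (q - (- (s * r)))" if "0 < s" for q r s :: real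
        using that by (simp add: field_simps)
      from this[OF scale_pos[of i e], unfolded k, of "p i $ e" "a $ i $ e"] show ?thesis
        by (simp only: u_def down_def up_def vec_lambda_beta vector_add_component)
    qed
    then show ?thesis by (simp add: vec_eq_iff)
  qed
  moreover have "up (u - a) $ i = p i" for i by (simp add: u_def)
  ultimately have "(u - a, u) \<in> Q" using p by (simp add: Q_def)
  then show ?thesis by blast
qed

text \<open>Since \<open>z\<close> is orthogonal to \<open>p\<close> and to any competitor
  \<open>r\<close>, the linear terms cancel in the sum of the subgradient inequalities.\<close>

lemma dual_solutionI:
  assumes z: "z \<in> nonant G \<tau>" and p: "p \<in> (nonant G \<tau>)\<^sup>\<bottom>"
    and sub: "\<And>i. - (z $ i) \<in> subdifferential (dual_term \<pi> f i) (p $ i)"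
  shows "dual_solution G \<tau> \<pi> f p"
  unfolding dual_solution_def is_minimizer_def
proof (intro conjI ballI p)
  fix r assume r: "r \<in> (nonant G \<tau>)\<^sup>\<bottom>"
  have "(\<Sum>i\<in>UNIV. dual_term \<pi> f i (p $ i)) = (\<Sum>i\<in>UNIV. dual_term \<pi> f i (p $ i)) + ereal (- z \<bullet> (r - p))"
    using orthogonal_comp_inner(1)[OF z r] orthogonal_comp_inner(1)[OF z p] by (simp add: inner_diff zero_ereal_def[symmetric])
  also have "\<dots> = (\<Sum>i\<in>UNIV. dual_term \<pi> f i (p $ i) + ereal (- (z $ i) \<bullet> (r $ i - p $ i)))"
    by (simp add: sum.distrib inner_vec_def)
  also have "\<dots> \<le> (\<Sum>i\<in>UNIV. dual_term \<pi> f i (r $ i))"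
    using sub by (intro sum_mono) (simp add: subdifferential_def)
  finally show "(\<Sum>i\<in>UNIV. dual_term \<pi> f i (p $ i)) \<le> (\<Sum>i\<in>UNIV. dual_term \<pi> f i (r $ i))" .
qed

lemma state_dual:
  assumes "splitting.state L Q Z W Z"
  shows "down Z \<in> nonant G \<tau>" and "up W \<in> (nonant G \<tau>)\<^sup>\<bottom>"
    and "- (down Z $ i) \<in> subdifferential (dual_term \<pi> f i) (up W $ i)"
proof -
  interpret splitting L Q by (rule splitting_dual)
  have *: "Z \<in> L" "W \<in> L\<^sup>\<bottom>" "(W, Z) \<in> Q" using assms by (auto simp: state_def)
  from *(1) show "down Z \<in> nonant G \<tau>" by auto
  from *(2) show "up W \<in> (nonant G \<tau>)\<^sup>\<bottom>" using down_orthogonal_comp[of "up W"] by simp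
  from *(3) show "- (down Z $ i) \<in> subdifferential (dual_term \<pi> f i) (up W $ i)" by (simp add: Q_def)
qed

text \<open>As \<open>p \<bullet> M x = 0\<close>, a vanishing duality gap is equality in
  Fenchel-Young, so \<open>- adjoint M p\<close> is a subgradient at \<open>x\<close>. Its blocks
  give subgradients of the dual terms, and the rescaled pair of \<open>M x\<close> and
  \<open>p\<close> is a fixed point.\<close>

lemma strong_duality_state:
  assumes "strong_duality G \<tau> \<pi> f"
  shows "\<exists>Z W. splitting.state L Q Z W Z"
proof -
  interpret splitting L Q by (rule splitting_dual)
  obtain x p where x: "M x \<in> nonant G \<tau>" and p: "p \<in> (nonant G \<tau>)\<^sup>\<bottom>"
    and eq: "primal_obj \<pi> f x + conjugate (primal_obj \<pi> f) (- adjoint M p) = 0"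
    using assms by (auto simp: strong_duality_def)
  note nm = primal_obj_not_minfty[of \<pi> f, OF pos f]
  obtain r where r: "primal_obj \<pi> f x = ereal r"
    using eq nm[of x] by (cases "primal_obj \<pi> f x") auto
  have conj: "conjugate (primal_obj \<pi> f) (- adjoint M p) = ereal (- r)"
    using eq r by (cases "conjugate (primal_obj \<pi> f) (- adjoint M p)") auto
  have adj: "adjoint M p \<bullet> y = p \<bullet> M y" for y :: "((real^'e) \<times> (real^'d))^'s"
    by (simp add: adjoint_M M_def inner_vec_def[where 'b = 's] inner_prod_def)
  have px: "p \<bullet> M x = 0" by (rule orthogonal_comp_inner(2)[OF x p])
  have "- adjoint M p \<in> subdifferential (primal_obj \<pi> f) x"
  proof (rule subdifferentialI[where F = "primal_obj \<pi> f", OF r nm])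
    fix y b assume b: "primal_obj \<pi> f y = ereal b"
    have "ereal (- adjoint M p \<bullet> y) - primal_obj \<pi> f y \<le> ereal (- r)"
      unfolding conj[symmetric] conjugate_def by (rule SUP_upper) simp
    then show "r + - adjoint M p \<bullet> (y - x) \<le> b" by (simp add: b inner_diff_right adj px)
  qed
  then have g: "(- ((1 / \<pi> i) *\<^sub>R p $ i), 0) \<in> subdifferential (f i) (x $ i)" for i
    using subdifferential_primal_obj[of \<pi> f, OF pos f] by (auto simp: adjoint_M)
  have "- fst (x $ i) \<in> subdifferential (dual_term \<pi> f i) (p $ i)" for i
    using subdifferential_dual_term(1)[of \<pi> i f, OF pos f g] pos[of i] by simp
  then have "(down p, up (M x)) \<in> Q" by (simp add: Q_def M_def)
  then have "state (up (M x)) (down p) (up (M x))"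
    using x p by (simp add: state_def down_orthogonal_comp)
  then show ?thesis by blast
qed

text \<open>Feasible differences have images under \<open>M\<close> orthogonal to
  \<open>weight w\<close>, so the subgradient inequality compares objective values directly.\<close>

lemma primal_solutionI:
  assumes x: "M x \<in> nonant G \<tau>" and w: "weight w \<in> (nonant G \<tau>)\<^sup>\<bottom>"
    and sub: "\<And>i. (- (w $ i), 0) \<in> subdifferential (f i) (x $ i)"
  shows "primal_solution G \<tau> \<pi> f x"
  unfolding primal_solution_def is_minimizer_def
proof (intro conjI ballI)
  show "x \<in> {x. M x \<in> nonant G \<tau>}" using x by simp
  fix y :: "((real^'e) \<times> (real^'d))^'s"
  assume "y \<in> {x. M x \<in> nonant G \<tau>}"
  then have y: "M y \<in> nonant G \<tau>" by simp
  have "- adjoint M (weight w) \<in> subdifferential (primal_obj \<pi> f) x"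
    using sub pos by (simp add: subdifferential_primal_obj[of \<pi> f, OF pos f] adjoint_M weight_def less_imp_neq[symmetric])
  then have "primal_obj \<pi> f x + ereal (- adjoint M (weight w) \<bullet> (y - x)) \<le> primal_obj \<pi> f y"
    by (simp add: subdifferential_def)
  moreover have "adjoint M (weight w) \<bullet> v = weight w \<bullet> M v" for v :: "((real^'e) \<times> (real^'d))^'s"
    by (simp add: adjoint_M M_def inner_vec_def[where 'b = 's] inner_prod_def)
  ultimately show "primal_obj \<pi> f x \<le> primal_obj \<pi> f y"
    using orthogonal_comp_inner(2)[OF x w] orthogonal_comp_inner(2)[OF y w]
    by (simp add: inner_diff_right zero_ereal_def[symmetric])
qed

end

text \<open>\<open>y k\<close> solves exactly the subproblem that \<open>x (Suc k)\<close> solves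
  within its tolerance; hence the index shift between the two sequences.\<close>

locale progressive_hedging = stochastic_program T G \<tau> \<pi> \<rho> f
  for T :: nat
    and G :: "('n, 's::finite) scenario_tree"
    and \<tau> :: "'e::finite \<Rightarrow> nat"
    and \<pi> :: "'s \<Rightarrow> real"
    and \<rho> :: "'e \<Rightarrow> real"
    and f :: "'s \<Rightarrow> (real^'e) \<times> (real^'d::finite) \<Rightarrow> ereal" +
  fixes \<sigma> :: "'s \<Rightarrow> nat \<Rightarrow> real"
    and \<nu> :: "nat \<Rightarrow> real"
    and z v w :: "nat \<Rightarrow> real^'e^'s"
    and x y :: "nat \<Rightarrow> ((real^'e) \<times> (real^'d))^'s"
    and a b :: real
  assumes le_one: "\<And>i. \<pi> i \<le> 1"
    and sigma: "\<And>i k. 0 \<le> \<sigma> i k" "\<And>i. summable (\<lambda>k. sqrt (\<sigma> i k))"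
    and nu: "0 < a" "\<And>k. a \<le> \<nu> k" "\<And>k. \<nu> k \<le> b" "b < 2"
    and z: "\<And>k. z k \<in> nonant G \<tau>"
    and w: "\<And>k. w k \<in> nonant_star G \<tau> \<pi>"
    and x_step: "\<And>k i. x (Suc k) $ i
        \<in> approx_arg_min (\<sigma> i k) UNIV (subproblem_obj \<rho> (f i) (w k $ i) (z k $ i))"
    and y_step: "\<And>k i. is_minimizer UNIV (subproblem_obj \<rho> (f i) (w k $ i) (z k $ i)) (y k $ i)"
    and z_step: "\<And>k i e. z (Suc k) $ i $ e = \<nu> k * v (Suc k) $ i $ e + (1 - \<nu> k) * z k $ i $ e"
    and w_step: "\<And>k i e. w (Suc k) $ i $ e =
        w k $ i $ e + \<nu> k * \<rho> e * (M (x (Suc k)) $ i $ e - v (Suc k) $ i $ e)"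
begin

definition multiplier :: "nat \<Rightarrow> 's \<Rightarrow> real^'e" where
  "multiplier k i = (\<chi> e. w k $ i $ e + \<rho> e * (fst (y k $ i) $ e - z k $ i $ e))"

lemma multiplier: "(- multiplier k i, 0) \<in> subdifferential (f i) (y k $ i)"
  unfolding multiplier_def by (rule subproblem_minimizer_subdifferential[OF f y_step])

lemma up_up_nth: "up (up d) $ i $ e = \<pi> i * \<rho> e * d $ i $ e"
proof -
  have "sqrt (\<pi> i * \<rho> e) * sqrt (\<pi> i * \<rho> e) = \<pi> i * \<rho> e" using pos[of i] rho[of e] by simp
  then show ?thesis unfolding up_def by (simp only: vec_lambda_beta mult.assoc[symmetric])
qed

text \<open>\<open>up\<close> applied twice multiplies by \<open>\<pi> i * \<rho> e\<close>, which
  turns the first component into \<open>\<pi> i\<close> times the multiplier of the exact solution;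
  the subgradient of \<open>f i\<close> there then passes to the dual term.\<close>

lemma exact_in_Q: "(down (weight (w k)) + up (M (y k)) - up (z k), up (M (y k))) \<in> Q"
proof -
  have "down (weight (w k)) + up (M (y k)) - up (z k) = down (weight (w k)) + up (M (y k) - z k)"
    by (simp add: linear_diff[OF linear_up])
  then have "up (down (weight (w k)) + up (M (y k)) - up (z k)) = weight (w k) + up (up (M (y k) - z k))"
    by (simp only: linear_add[OF linear_up] up_down)
  also have "(weight (w k) + up (up (M (y k) - z k))) $ i = \<pi> i *\<^sub>R multiplier k i" for i
    by (simp add: vec_eq_iff up_up_nth weight_def multiplier_def M_def algebra_simps)
  finally have "up (down (weight (w k)) + up (M (y k)) - up (z k)) $ i = \<pi> i *\<^sub>R multiplier k i" for i .
  moreover have "- (M (y k) $ i) \<in> subdifferential (dual_term \<pi> f i) (\<pi> i *\<^sub>R multiplier k i)" for i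
    using subdifferential_dual_term(1)[of \<pi> i f, OF pos f multiplier] by (simp add: M_def)
  ultimately show ?thesis by (simp add: Q_def)
qed

lemma weight_w: "weight (w k) \<in> (nonant G \<tau>)\<^sup>\<bottom>"
  unfolding weight_def by (rule nonant_star_weighted_orthogonal_comp[OF tree stages w])

text \<open>The contributions of \<open>v\<close> to the updates of \<open>z\<close> and
  \<open>w\<close> cancel in the scaled sum, which leaves a relaxed step driven by the computed
  point.\<close>

lemma step_scaled:
  "up (z (Suc k)) + down (weight (w (Suc k)))
    = up (z k) + down (weight (w k)) + \<nu> k *\<^sub>R (up (M (x (Suc k))) - up (z k))"
proof -
  have "(up (z (Suc k)) + down (weight (w (Suc k)))) $ i $ e
      = (up (z k) + down (weight (w k)) + \<nu> k *\<^sub>R (up (M (x (Suc k))) - up (z k))) $ i $ e" for i e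
  proof -
    have k: "sqrt (\<pi> i * \<rho> e) * sqrt (\<pi> i * \<rho> e) = \<pi> i * \<rho> e" using pos[of i] rho[of e] by simp
    have *: "s * (n * vv + (1 - n) * zz) + p * (ww + n * r * (u - vv)) / s
        = s * zz + p * ww / s + n * (s * u - s * zz)" if "0 < s" "s * s = p * r" for s n vv zz p ww r u :: real
    proof -
      have "p * (ww + n * r * (u - vv)) / s = p * ww / s + n * (u - vv) * (s * s) / s"
        unfolding that(2) by (simp add: add_divide_distrib[symmetric] algebra_simps)
      also have "\<dots> = p * ww / s + n * (u - vv) * s" using that(1) by simp
      finally show ?thesis by (simp add: algebra_simps)
    qed
    show ?thesis
      using *[OF scale_pos[of i e] k] by (simp add: up_def down_def weight_def z_step w_step)
  qed
  then show ?thesis by (simp add: vec_eq_iff)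
qed

text \<open>In scaled coordinates the squared error of block \<open>i\<close> is
  \<open>\<pi> i\<close> times the quantity in \<open>approx_subproblem_error\<close>, and
  \<open>\<pi> i \<le> 1\<close>; the norm is at most the sum of the block norms.\<close>

lemma inexact_le:
  "norm (up (M (x (Suc k))) - up (M (y k))) \<le> (\<Sum>i\<in>UNIV. sqrt (2 * \<sigma> i k))"
proof -
  let ?d = "up (M (x (Suc k)) - M (y k))"
  have "norm (?d $ i) \<le> sqrt (2 * \<sigma> i k)" for i
  proof (rule real_le_rsqrt)
    let ?s = "\<Sum>e\<in>UNIV. \<rho> e * (fst (x (Suc k) $ i) $ e - fst (y k $ i) $ e)\<^sup>2"
    have "(norm (?d $ i))\<^sup>2 = (\<Sum>e\<in>UNIV. (?d $ i $ e)\<^sup>2)"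
      by (simp only: power2_norm_eq_inner) (simp add: inner_vec_def power2_eq_square)
    also have "\<dots> = \<pi> i * ?s"
      unfolding sum_distrib_left
      using pos[of i] rho by (intro sum.cong refl) (simp add: up_def M_def power_mult_distrib less_imp_le)
    also have "\<dots> \<le> 1 * (2 * \<sigma> i k)"
    proof (rule mult_mono[OF le_one])
      show "?s \<le> 2 * \<sigma> i k" by (rule approx_subproblem_error[OF f x_step y_step])
      show "0 \<le> ?s" using rho by (intro sum_nonneg) (simp add: less_imp_le)
    qed simp
    finally show "(norm (?d $ i))\<^sup>2 \<le> 2 * \<sigma> i k" by simp
  qed
  then have "(\<Sum>i\<in>UNIV. norm (?d $ i)) \<le> (\<Sum>i\<in>UNIV. sqrt (2 * \<sigma> i k))" by (intro sum_mono)
  moreover have "norm ?d \<le> (\<Sum>i\<in>UNIV. norm (?d $ i))"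
    unfolding norm_vec_def by (intro L2_set_le_sum) simp
  ultimately show ?thesis by (simp add: linear_diff[OF linear_up])
qed

sublocale splitting_sequence L Q "\<lambda>k. up (z k)" "\<lambda>k. down (weight (w k))" "\<lambda>k. up (M (y k))"
  "\<lambda>k. up (M (x (Suc k)))" \<nu> "\<lambda>k. \<Sum>i\<in>UNIV. sqrt (2 * \<sigma> i k)" a b
proof (rule splitting_sequence.intro[OF splitting_dual], unfold_locales)
  interpret splitting L Q by (rule splitting_dual)
  show "state (up (z k)) (down (weight (w k))) (up (M (y k)))" for k
    using z weight_w exact_in_Q by (simp add: state_def down_orthogonal_comp)
  show "summable (\<lambda>k. \<Sum>i\<in>UNIV. sqrt (2 * \<sigma> i k))"
    unfolding real_sqrt_mult by (intro summable_sum summable_mult sigma)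
qed (use step_scaled inexact_le nu in auto)

lemma w_eq: "w k = (\<chi> i. (1 / \<pi> i) *\<^sub>R weight (w k) $ i)"
  using pos by (simp add: weight_def vec_eq_iff less_imp_neq[symmetric])

theorem strong_duality_convergence:
  assumes "strong_duality G \<tau> \<pi> f"
  obtains w' z' where "w' \<in> nonant_star G \<tau> \<pi>" and "z' \<in> nonant G \<tau>" and "w \<longlonglongrightarrow> w'" and "z \<longlonglongrightarrow> z'"
    and "v \<longlonglongrightarrow> z'" and "(\<lambda>k. M (x k)) \<longlonglongrightarrow> z'" and "(\<lambda>k. M (y k)) \<longlonglongrightarrow> z'"
    and "\<And>i. - (z' $ i) \<in> subdifferential (dual_term \<pi> f i) (\<pi> i *\<^sub>R w' $ i)"
proof -
  obtain Z W where st: "state Z W Z" and Z: "(\<lambda>k. up (z k)) \<longlonglongrightarrow> Z"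
    and W: "(\<lambda>k. down (weight (w k))) \<longlonglongrightarrow> W" and V: "(\<lambda>k. up (M (x (Suc k)))) \<longlonglongrightarrow> Z"
    and U: "(\<lambda>k. up (M (y k))) \<longlonglongrightarrow> Z"
    using convergence[OF strong_duality_state[OF assms]] by metis
  define z' where "z' = down Z"
  define w' where "w' = (\<chi> i. (1 / \<pi> i) *\<^sub>R up W $ i)"
  have zlim: "z \<longlonglongrightarrow> z'" using tendsto_down[OF Z] by (simp add: z'_def)
  have xlim: "(\<lambda>k. M (x (Suc k))) \<longlonglongrightarrow> z'" using tendsto_down[OF V] by (simp add: z'_def)
  have ylim: "(\<lambda>k. M (y k)) \<longlonglongrightarrow> z'" using tendsto_down[OF U] by (simp add: z'_def)
  have "(\<lambda>k. weight (w k)) \<longlonglongrightarrow> up W" using tendsto_up[OF W] by simp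
  then have "(\<lambda>k. \<chi> i. (1 / \<pi> i) *\<^sub>R weight (w k) $ i) \<longlonglongrightarrow> w'"
    unfolding w'_def by (intro tendsto_vec_lambda tendsto_scaleR tendsto_const tendsto_vec_nth)
  then have wlim: "w \<longlonglongrightarrow> w'" by (simp only: w_eq[symmetric])
  \<comment> \<open>By \<open>z_step\<close> this difference is \<open>z (Suc k) - z k\<close>
    divided by \<open>\<nu> k \<ge> a\<close>, so \<open>v\<close> inherits the limit of
    \<open>z\<close>.\<close>
  have "(\<lambda>k. v (Suc k) - z k) \<longlonglongrightarrow> 0"
  proof (rule Lim_null_comparison)
    show "\<forall>\<^sub>F k in sequentially. norm (v (Suc k) - z k) \<le> norm (z (Suc k) - z k) / a"
    proof (intro always_eventually allI)
      fix k
      have "z (Suc k) - z k = \<nu> k *\<^sub>R (v (Suc k) - z k)"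
        by (simp add: vec_eq_iff z_step algebra_simps)
      then have "a * norm (v (Suc k) - z k) \<le> norm (z (Suc k) - z k)"
        using nu_pos[of k] nu(2)[of k] by (simp add: mult_right_mono)
      then show "norm (v (Suc k) - z k) \<le> norm (z (Suc k) - z k) / a"
        using nu(1) by (simp add: pos_le_divide_eq mult.commute)
    qed
    have "(\<lambda>k. norm (z (Suc k) - z k) / a) \<longlonglongrightarrow> norm (z' - z') / a"
      using nu(1) by (intro tendsto_intros zlim LIMSEQ_Suc[OF zlim]) simp
    then show "(\<lambda>k. norm (z (Suc k) - z k) / a) \<longlonglongrightarrow> 0" by simp
  qed
  from tendsto_add[OF this zlim] have "(\<lambda>k. v (Suc k)) \<longlonglongrightarrow> z'" by simp
  then have vlim: "v \<longlonglongrightarrow> z'" by (rule LIMSEQ_imp_Suc)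
  have "w' \<in> nonant_star G \<tau> \<pi>"
    by (rule closed_sequentially[OF closed_nonant_star _ wlim]) (use w in simp)
  moreover have "z' \<in> nonant G \<tau>" unfolding z'_def by (rule state_dual(1)[OF st])
  moreover have "- (z' $ i) \<in> subdifferential (dual_term \<pi> f i) (\<pi> i *\<^sub>R w' $ i)" for i
    using state_dual(3)[OF st, of i] pos[of i] by (simp add: z'_def w'_def)
  ultimately show thesis
    using that wlim zlim vlim ylim LIMSEQ_imp_Suc[OF xlim] by blast
qed

text \<open>The multipliers of the exact solutions converge to \<open>w'\<close> because
  \<open>M (y k)\<close> and \<open>z k\<close> share their limit. The regularity condition passes
  to each block, and closedness under \<open>fst\<close> produces the last-stage part.\<close>

lemma regular_primal_subgradient:
  assumes lim: "w \<longlonglongrightarrow> w'" "z \<longlonglongrightarrow> z'" "(\<lambda>k. M (y k)) \<longlonglongrightarrow> z'"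
    and reg: "rel_interior (\<Union>u. subdifferential (primal_obj \<pi> f) u)
      \<inter> range (adjoint (M :: ((real^'e) \<times> (real^'d))^'s \<Rightarrow> real^'e^'s)) \<noteq> {}"
  shows "\<exists>xT. (- (w' $ i), 0) \<in> subdifferential (f i) (z' $ i, xT)"
proof -
  obtain p where p: "adjoint M p \<in> rel_interior (\<Union>u. subdifferential (primal_obj \<pi> f) u)"
    using reg by blast
  obtain \<delta> where \<delta>: "0 < \<delta>"
      "adjoint fst ((1 / \<pi> i) *\<^sub>R p $ i) \<in> (\<Union>u. subdifferential (f i) u)"
      "\<And>e. e \<in> span ((\<lambda>y. y - adjoint fst ((1 / \<pi> i) *\<^sub>R p $ i)) ` (\<Union>u. subdifferential (f i) u))
        \<Longrightarrow> norm e < \<delta> \<Longrightarrow> adjoint fst ((1 / \<pi> i) *\<^sub>R p $ i) + e \<in> (\<Union>u. subdifferential (f i) u)"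
    using rel_interior_primal_obj_component[of \<pi> f p _ i, OF pos f p refl] by metis
  have ylim: "(\<lambda>k. fst (y k $ i)) \<longlonglongrightarrow> z' $ i"
    using tendsto_vec_nth[OF lim(3), of i] by (simp add: M_def)
  have "(\<lambda>k. - multiplier k i) \<longlonglongrightarrow> - (\<chi> e. w' $ i $ e + \<rho> e * (z' $ i $ e - z' $ i $ e))"
    unfolding multiplier_def
    by (intro tendsto_intros tendsto_vec_lambda tendsto_vec_nth lim ylim)
  then have q: "(\<lambda>k. - multiplier k i) \<longlonglongrightarrow> - (w' $ i)" by simp
  have "\<exists>u. fst u = z' $ i \<and> adjoint fst (- (w' $ i)) \<in> subdifferential (f i) u"
    by (rule subdifferential_closed_under_map[OF f _ refl \<delta>(2,1,3) _ q ylim])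
      (use multiplier in \<open>auto simp: adjoint_fst linear_fst\<close>)
  then show ?thesis by (auto simp: adjoint_fst)
qed

text \<open>Approximate minimality of the iterates is tested against \<open>x'\<close>, whose
  retained part \<open>z'\<close> is also the limit of theirs. The penalties cancel in the limit, so
  each \<open>f i\<close> is no larger at the limit point than at \<open>x'\<close>.\<close>

lemma limit_point_primal_solution:
  assumes lim: "w \<longlonglongrightarrow> w'" "z \<longlonglongrightarrow> z'" "(\<lambda>k. M (x k)) \<longlonglongrightarrow> z'"
    and sol: "primal_solution G \<tau> \<pi> f x'" "z' = M x'" and fin: "\<And>i. f i (x' $ i) = ereal (\<beta> i)"
    and r: "strict_mono r" "(x \<circ> r) \<longlonglongrightarrow> u"
  shows "primal_solution G \<tau> \<pi> f u"
proof -
  \<comment> \<open>\<open>x (r k)\<close> stems from the subproblem of step \<open>r k - 1\<close>;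
    the index \<open>Suc k\<close> guarantees \<open>r (Suc k) \<ge> 1\<close>, so the subtraction
    is exact.\<close>
  define m where "m k = r (Suc k) - 1" for k
  have m: "Suc (m k) = r (Suc k)" for k
    using strict_mono_imp_increasing[OF r(1), of "Suc k"] by (simp add: m_def)
  have "m k < m (Suc k)" for k
    using m[of k] m[of "Suc k"] strict_monoD[OF r(1), of "Suc k" "Suc (Suc k)"] by simp
  then have sm: "strict_mono m" by (simp add: strict_mono_Suc_iff)
  have xlim: "(\<lambda>k. x (Suc (m k))) \<longlonglongrightarrow> u" using LIMSEQ_Suc[OF r(2)] by (simp add: m)
  have wlim: "(\<lambda>k. w (m k)) \<longlonglongrightarrow> w'" using LIMSEQ_subseq_LIMSEQ[OF lim(1) sm] by (simp add: o_def)
  have zlim: "(\<lambda>k. z (m k)) \<longlonglongrightarrow> z'" using LIMSEQ_subseq_LIMSEQ[OF lim(2) sm] by (simp add: o_def)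
  have fu: "fst (u $ i) = z' $ i" for i
  proof -
    have "(\<lambda>k. fst (x (r k) $ i)) \<longlonglongrightarrow> fst (u $ i)"
      using r(2) by (intro tendsto_fst tendsto_vec_nth) (simp add: o_def)
    moreover have "(\<lambda>k. fst (x (r k) $ i)) \<longlonglongrightarrow> z' $ i"
      using tendsto_vec_nth[OF LIMSEQ_subseq_LIMSEQ[OF lim(3) r(1)], of i] by (simp add: o_def M_def)
    ultimately show ?thesis by (rule LIMSEQ_unique)
  qed
  have le: "f i (u $ i) \<le> f i (x' $ i)" for i
  proof -
    have "(\<lambda>k. (sqrt (\<sigma> i k))\<^sup>2) \<longlonglongrightarrow> 0\<^sup>2"
      by (intro tendsto_power summable_LIMSEQ_zero sigma)
    then have "\<sigma> i \<longlonglongrightarrow> 0" using sigma(1) by simp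
    then have slim: "(\<lambda>k. \<sigma> i (m k)) \<longlonglongrightarrow> 0"
      using LIMSEQ_subseq_LIMSEQ[OF _ sm] by (fastforce simp: o_def)
    have plim: "(\<lambda>k. penalty \<rho> (w (m k) $ i) (z (m k) $ i) (c k)) \<longlonglongrightarrow> penalty \<rho> (w' $ i) (z' $ i) (z' $ i)"
      if "c \<longlonglongrightarrow> z' $ i" for c
      unfolding penalty_def by (intro tendsto_intros tendsto_vec_nth wlim zlim that) auto
    have "(\<lambda>k. fst (x (Suc (m k)) $ i)) \<longlonglongrightarrow> z' $ i"
      using tendsto_fst[OF tendsto_vec_nth[OF xlim]] by (simp add: fu)
    then have rlim: "(\<lambda>k. \<beta> i + penalty \<rho> (w (m k) $ i) (z (m k) $ i) (z' $ i) + \<sigma> i (m k)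
        - penalty \<rho> (w (m k) $ i) (z (m k) $ i) (fst (x (Suc (m k)) $ i)))
      \<longlonglongrightarrow> \<beta> i + penalty \<rho> (w' $ i) (z' $ i) (z' $ i) + 0 - penalty \<rho> (w' $ i) (z' $ i) (z' $ i)"
      by (intro tendsto_intros plim slim)
    have "f i (x (Suc (m k)) $ i) \<le> ereal (\<beta> i + penalty \<rho> (w (m k) $ i) (z (m k) $ i) (z' $ i) + \<sigma> i (m k)
        - penalty \<rho> (w (m k) $ i) (z (m k) $ i) (fst (x (Suc (m k)) $ i)))" for k
      using approx_subproblem_le[OF x_step[of "m k" i] closed_proper_convex_not_minfty[OF f] fin[of i]]
      by (simp add: sol(2) M_def)
    from closed_proper_convex_limit[OF f tendsto_vec_nth[OF xlim] rlim this] show ?thesis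
      by (simp add: fin)
  qed
  have "M u = M x'" using fu sol(2) by (simp add: M_def vec_eq_iff)
  moreover have "primal_obj \<pi> f u \<le> primal_obj \<pi> f x'"
    unfolding primal_obj_def
    by (intro sum_mono ereal_mult_left_mono le) (use pos in \<open>simp add: less_imp_le\<close>)
  ultimately show ?thesis
    using sol(1) unfolding primal_solution_def is_minimizer_def by (auto intro: order_trans)
qed

lemma dual_solution_if_bounded:
  assumes "bounded (range w)" and "bounded (range z)"
  shows "\<exists>p. dual_solution G \<tau> \<pi> f p"
proof -
  have lin: "linear weight"
    by (rule linearI) (auto simp: weight_def vec_eq_iff scaleR_add_right distrib_left)
  have "bounded_linear (\<lambda>y. down (weight y))"
    using linear_compose[OF lin linear_down] by (simp add: o_def linear_conv_bounded_linear)
  from bounded_linear_image[OF assms(1) this]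
  have bw: "bounded (range (\<lambda>k. down (weight (w k))))" by (simp only: image_image)
  from bounded_linear_image[OF assms(2)] linear_up
  have bz: "bounded (range (\<lambda>k. up (z k)))"
    by (simp only: image_image linear_conv_bounded_linear)
  obtain Z W where "state Z W Z"
    using bounded_imp_zero[OF bz bw minty] by blast
  then show ?thesis using dual_solutionI[OF state_dual] by blast
qed

end

section \<open>Assembly of the convergence, regularity and unboundedness claims\<close>

theorem proposition19:
  fixes T :: nat
    and G :: "('n, 's::finite) scenario_tree"
    and \<tau> :: "'e::finite \<Rightarrow> nat"
    and \<pi> :: "'s \<Rightarrow> real"
    and \<rho> :: "'e \<Rightarrow> real"
    and f :: "'s \<Rightarrow> (real^'e) \<times> (real^'d::finite) \<Rightarrow> ereal"
    and \<sigma> :: "'s \<Rightarrow> nat \<Rightarrow> real"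
    and \<nu> :: "nat \<Rightarrow> real"
    and z v w :: "nat \<Rightarrow> real^'e^'s"
    and x :: "nat \<Rightarrow> ((real^'e) \<times> (real^'d))^'s"
  assumes tree: "is_scenario_tree T G"
    and stages: "range \<tau> = {1..<T}"
    and prob: "\<And>i. 0 < \<pi> i \<and> \<pi> i \<le> 1" "(\<Sum>i\<in>UNIV. \<pi> i) = 1"
    and rho: "\<And>e. \<rho> e > 0"
    and f: "\<And>i. closed_proper_convex (f i)"
    and sigma: "\<And>i k. \<sigma> i k \<ge> 0" "\<And>i. summable (\<lambda>k. sqrt (\<sigma> i k))"
    and nu: "0 < (INF k. ereal (\<nu> k))" "(SUP k. ereal (\<nu> k)) < 2"
    and spaces: "\<And>k. z k \<in> nonant G \<tau>" "\<And>k. v (Suc k) \<in> nonant G \<tau>"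
      "\<And>k. w k \<in> nonant_star G \<tau> \<pi>"
    and x_step: "\<And>k i. x (Suc k) $ i
        \<in> approx_arg_min (\<sigma> i k) UNIV (subproblem_obj \<rho> (f i) (w k $ i) (z k $ i))"
    and attained: "\<And>k i. \<exists>y. is_minimizer UNIV (subproblem_obj \<rho> (f i) (w k $ i) (z k $ i)) y"
    and v_step: "\<And>k N i e. \<lbrakk>N \<in> nonleaf_nodes G; i \<in> leaf_descendants G N; \<tau> e = stage G N\<rbrakk>
        \<Longrightarrow> v (Suc k) $ i $ e =
          1 / node_prob G \<pi> N * (\<Sum>i'\<in>leaf_descendants G N. \<pi> i' * M (x (Suc k)) $ i' $ e)"
    and z_step: "\<And>k i e. z (Suc k) $ i $ e = \<nu> k * v (Suc k) $ i $ e + (1 - \<nu> k) * z k $ i $ e"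
    and w_step: "\<And>k i e. w (Suc k) $ i $ e =
        w k $ i $ e + \<nu> k * \<rho> e * (M (x (Suc k)) $ i $ e - v (Suc k) $ i $ e)"
  shows "(strong_duality G \<tau> \<pi> f \<longrightarrow>
      (\<exists>w' \<in> nonant_star G \<tau> \<pi>. \<exists>z' \<in> nonant G \<tau>.
         w \<longlonglongrightarrow> w' \<and>
         (\<chi> i. \<pi> i *\<^sub>R w' $ i) \<in> (nonant G \<tau>)\<^sup>\<bottom> \<and>
         dual_solution G \<tau> \<pi> f (\<chi> i. \<pi> i *\<^sub>R w' $ i) \<and>
         z \<longlonglongrightarrow> z' \<and> v \<longlonglongrightarrow> z' \<and> (\<lambda>k. M (x k)) \<longlonglongrightarrow> z' \<and>
         (\<forall>i. - (z' $ i) \<in> subdifferential (dual_term \<pi> f i) (\<pi> i *\<^sub>R w' $ i)) \<and>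
         (rel_interior (\<Union>y. subdifferential (primal_obj \<pi> f) y)
            \<inter> range (adjoint (M :: ((real^'e) \<times> (real^'d))^'s \<Rightarrow> real^'e^'s)) \<noteq> {} \<longrightarrow>
            (\<exists>x'. primal_solution G \<tau> \<pi> f x' \<and> z' = M x') \<and>
            (\<forall>y r. strict_mono r \<and> (x \<circ> r) \<longlonglongrightarrow> y \<longrightarrow> primal_solution G \<tau> \<pi> f y) \<and>
            (\<forall>i. \<exists>xT. (- (w' $ i), 0) \<in> subdifferential (f i) (z' $ i, xT)))))
    \<and> ((\<nexists>p. dual_solution G \<tau> \<pi> f p) \<and> (\<exists>p. \<bar>dual_obj G \<tau> \<pi> f p\<bar> \<noteq> \<infinity>) \<longrightarrow>
        \<not> bounded (range w) \<or> \<not> bounded (range z))"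
proof -
  have pos: "\<And>i. 0 < \<pi> i" and le_one: "\<And>i. \<pi> i \<le> 1" using prob(1) by auto
  \<comment> \<open>A real number strictly between 0 and the extended-valued infimum bounds all
    relaxation parameters below; \<open>b\<close> arises likewise from the supremum.\<close>
  obtain a where a: "0 < a" "\<And>k. a \<le> \<nu> k"
  proof -
    obtain a where "0 < ereal a" "ereal a < (INF k. ereal (\<nu> k))"
      using ereal_dense2[OF nu(1)] by blast
    moreover have "(INF k. ereal (\<nu> k)) \<le> ereal (\<nu> k)" for k by (rule INF_lower) simp
    ultimately show thesis using that[of a]
      by (metis ereal_less(2) ereal_less_eq(3) less_imp_le order_trans)
  qed
  obtain b where b: "b < 2" "\<And>k. \<nu> k \<le> b"
  proof -
    obtain b where b: "(SUP k. ereal (\<nu> k)) < ereal b" "ereal b < 2"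
      using ereal_dense2[OF nu(2)] by blast
    moreover have "ereal (\<nu> k) \<le> (SUP k. ereal (\<nu> k))" for k by (rule SUP_upper) simp
    moreover have "b < 2" using b(2) by simp
    ultimately show thesis using that[of b]
      by (metis ereal_less_eq(3) less_imp_le order_trans)
  qed
  define y where
    "y k = (\<chi> i. SOME u. is_minimizer UNIV (subproblem_obj \<rho> (f i) (w k $ i) (z k $ i)) u)" for k
  have y: "is_minimizer UNIV (subproblem_obj \<rho> (f i) (w k $ i) (z k $ i)) (y k $ i)" for k i
    using someI_ex[OF attained] by (simp add: y_def)
  \<comment> \<open>An exact subproblem solution exhibits a point where the dual term is finite,
    which gives properness.\<close>
  have dual: "closed_proper_convex (dual_term \<pi> f i)" for i
    using dual_term_closed_proper_convex[of \<pi> i f, OF pos f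
        subdifferential_dual_term(2)[of \<pi> i f, OF pos f subproblem_minimizer_subdifferential[OF f y]]] .
  interpret progressive_hedging T G \<tau> \<pi> \<rho> f \<sigma> \<nu> z v w x y a b
    by unfold_locales (fact tree stages pos rho f dual le_one sigma a b spaces x_step y z_step w_step)+
  show ?thesis
  proof (intro conjI impI)
    assume "strong_duality G \<tau> \<pi> f"
    then obtain w' z' where *: "w' \<in> nonant_star G \<tau> \<pi>" "z' \<in> nonant G \<tau>" "w \<longlonglongrightarrow> w'" "z \<longlonglongrightarrow> z'"
        "v \<longlonglongrightarrow> z'" "(\<lambda>k. M (x k)) \<longlonglongrightarrow> z'" "(\<lambda>k. M (y k)) \<longlonglongrightarrow> z'"
      and sub: "\<And>i. - (z' $ i) \<in> subdifferential (dual_term \<pi> f i) (\<pi> i *\<^sub>R w' $ i)"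
      using strong_duality_convergence by metis
    have w': "weight w' \<in> (nonant G \<tau>)\<^sup>\<bottom>"
      unfolding weight_def by (rule nonant_star_weighted_orthogonal_comp[OF tree stages *(1)])
    have dual_sol: "dual_solution G \<tau> \<pi> f (weight w')"
      by (rule dual_solutionI[OF *(2) w']) (use sub in \<open>simp add: weight_def\<close>)
    have regular: "(\<exists>x'. primal_solution G \<tau> \<pi> f x' \<and> z' = M x') \<and>
            (\<forall>y r. strict_mono r \<and> (x \<circ> r) \<longlonglongrightarrow> y \<longrightarrow> primal_solution G \<tau> \<pi> f y) \<and>
            (\<forall>i. \<exists>xT. (- (w' $ i), 0) \<in> subdifferential (f i) (z' $ i, xT))"
      if reg: "rel_interior (\<Union>y. subdifferential (primal_obj \<pi> f) y)
            \<inter> range (adjoint (M :: ((real^'e) \<times> (real^'d))^'s \<Rightarrow> real^'e^'s)) \<noteq> {}"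
    proof -
      have ex: "\<exists>xT. (- (w' $ i), 0) \<in> subdifferential (f i) (z' $ i, xT)" for i
        by (rule regular_primal_subgradient[OF *(3,4,7) reg])
      then obtain xT where xT: "\<And>i. (- (w' $ i), 0) \<in> subdifferential (f i) (z' $ i, xT i)" by metis
      define x' :: "((real^'e) \<times> (real^'d))^'s" where "x' = (\<chi> i. (z' $ i, xT i))"
      have Mx': "z' = M x'" by (simp add: x'_def M_def vec_eq_iff)
      have sub': "(- (w' $ i), 0) \<in> subdifferential (f i) (x' $ i)" for i
        using xT by (simp add: x'_def)
      have sol: "primal_solution G \<tau> \<pi> f x'"
        by (rule primal_solutionI[OF _ w' sub']) (use *(2) Mx' in simp)
      have "\<forall>i. \<exists>\<beta>. f i (x' $ i) = ereal \<beta>"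
        using closed_proper_convex_subdifferential_finite[OF f sub'] by metis
      then obtain \<beta> where \<beta>: "\<And>i. f i (x' $ i) = ereal (\<beta> i)" by metis
      show ?thesis
        using sol Mx' ex limit_point_primal_solution[OF *(3,4,6) sol Mx' \<beta>] by blast
    qed
    show "\<exists>w' \<in> nonant_star G \<tau> \<pi>. \<exists>z' \<in> nonant G \<tau>.
         w \<longlonglongrightarrow> w' \<and>
         (\<chi> i. \<pi> i *\<^sub>R w' $ i) \<in> (nonant G \<tau>)\<^sup>\<bottom> \<and>
         dual_solution G \<tau> \<pi> f (\<chi> i. \<pi> i *\<^sub>R w' $ i) \<and>
         z \<longlonglongrightarrow> z' \<and> v \<longlonglongrightarrow> z' \<and> (\<lambda>k. M (x k)) \<longlonglongrightarrow> z' \<and>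
         (\<forall>i. - (z' $ i) \<in> subdifferential (dual_term \<pi> f i) (\<pi> i *\<^sub>R w' $ i)) \<and>
         (rel_interior (\<Union>y. subdifferential (primal_obj \<pi> f) y)
            \<inter> range (adjoint (M :: ((real^'e) \<times> (real^'d))^'s \<Rightarrow> real^'e^'s)) \<noteq> {} \<longrightarrow>
            (\<exists>x'. primal_solution G \<tau> \<pi> f x' \<and> z' = M x') \<and>
            (\<forall>y r. strict_mono r \<and> (x \<circ> r) \<longlonglongrightarrow> y \<longrightarrow> primal_solution G \<tau> \<pi> f y) \<and>
            (\<forall>i. \<exists>xT. (- (w' $ i), 0) \<in> subdifferential (f i) (z' $ i, xT)))"
      using *(1-6) w' dual_sol sub regular unfolding weight_def
      by (intro bexI[of _ w'] bexI[of _ z'] conjI allI impI) auto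
  next
    assume "(\<nexists>p. dual_solution G \<tau> \<pi> f p) \<and> (\<exists>p. \<bar>dual_obj G \<tau> \<pi> f p\<bar> \<noteq> \<infinity>)"
    then show "\<not> bounded (range w) \<or> \<not> bounded (range z)"
      using dual_solution_if_bounded by blast
  qed
qed

end
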